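(* Let $q$ be a power of a prime $p$, let $\mathbb{F}_q$ be the finite field with $q$ elements, let $V$ be an $\mathbb{F}_q$-vector space of finite dimension $d$, and let $G \subseteq GL(V)$ be a subgroup. Let $R = \mathbb{F}_q[V] = \operatorname{Sym}(V^* )$, let $S = R^G$ be the ring of invariants, and let $\mathbf{d}_{d,0} = \prod_{0 \neq v \in V^*} v \in S$. For each $i$ let $J_i = \operatorname{ann}_S H^i(G,R)$. Then for every $i \geq 1$ we have $\mathbf{d}_{d,0} \in \sqrt{J_i}$.
   Context: The group $G$ (which is finite) acts on $V^*$ by the dual action and on $R = \operatorname{Sym}(V^* )$ by the induced $\mathbb{F}_q$-algebra automorphisms. The element $\mathbf{d}_{d,0}$, the product of all nonzero linear forms $v \in V^*$, is called the top Dickson class; it is invariant under $GL(V)$, so it lies in $S$. The ring $R$ is a module over the group ring $S[G]$. $H^i(G,-)$ denotes the $i$-th right derived functor of the fixed-point functor $M \mapsto M^G$ from $S[G]$-modules to $S$-modules, equivalently $H^i(G,M) = \operatorname{Ext}^i_{S[G]}(S,M)$ where $S$ has trivial $G$-action; in particular $H^i(G,R)$ is an $S$-module. $\sqrt{J}$ denotes the radical of the ideal $J$ in $S$. *)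

theory Defs
  imports
    "HOL-Algebra.Algebra"
    "HOL-Algebra.Algebraic_Closure_Type"
    "HOL-Library.Poly_Mapping"
begin

text \<open>
  The locale \<^locale>\<open>module\<close> requires a commutative base ring; group rings are not commutative.
  We reuse its record type; the multiplicative fields of the record play no role.
\<close>

locale left_module = A?: ring A + M?: abelian_group M
  for A :: "('a, 'c) ring_scheme" (structure) and M :: "('a, 'b, 'd) module_scheme" (structure) +
  assumes lsmult_closed:
      "\<lbrakk>a \<in> carrier A; x \<in> carrier M\<rbrakk> \<Longrightarrow> a \<odot>\<^bsub>M\<^esub> x \<in> carrier M"
    and lsmult_l_distr:
      "\<lbrakk>a \<in> carrier A; b \<in> carrier A; x \<in> carrier M\<rbrakk>
        \<Longrightarrow> (a \<oplus>\<^bsub>A\<^esub> b) \<odot>\<^bsub>M\<^esub> x = (a \<odot>\<^bsub>M\<^esub> x) \<oplus>\<^bsub>M\<^esub> (b \<odot>\<^bsub>M\<^esub> x)"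
    and lsmult_r_distr:
      "\<lbrakk>a \<in> carrier A; x \<in> carrier M; y \<in> carrier M\<rbrakk>
        \<Longrightarrow> a \<odot>\<^bsub>M\<^esub> (x \<oplus>\<^bsub>M\<^esub> y) = (a \<odot>\<^bsub>M\<^esub> x) \<oplus>\<^bsub>M\<^esub> (a \<odot>\<^bsub>M\<^esub> y)"
    and lsmult_assoc:
      "\<lbrakk>a \<in> carrier A; b \<in> carrier A; x \<in> carrier M\<rbrakk>
        \<Longrightarrow> (a \<otimes>\<^bsub>A\<^esub> b) \<odot>\<^bsub>M\<^esub> x = a \<odot>\<^bsub>M\<^esub> (b \<odot>\<^bsub>M\<^esub> x)"
    and lsmult_one:
      "x \<in> carrier M \<Longrightarrow> \<one>\<^bsub>A\<^esub> \<odot>\<^bsub>M\<^esub> x = x"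

definition mod_hom ::
  "'a ring \<Rightarrow> ('a, 'm) module \<Rightarrow> ('a, 'n) module \<Rightarrow> ('m \<Rightarrow> 'n) set"
  where "mod_hom A M N =
    {f \<in> carrier M \<rightarrow>\<^sub>E carrier N.
       (\<forall>x\<in>carrier M. \<forall>y\<in>carrier M. f (x \<oplus>\<^bsub>M\<^esub> y) = f x \<oplus>\<^bsub>N\<^esub> f y) \<and>
       (\<forall>a\<in>carrier A. \<forall>x\<in>carrier M. f (a \<odot>\<^bsub>M\<^esub> x) = a \<odot>\<^bsub>N\<^esub> f x)}"

text \<open>
  The lifting property. A definition cannot quantify over types, so the test modules live on the
  types \<open>'p \<Rightarrow> 'a\<close> and \<open>'p\<close>. This loses nothing: it includes the lifting of the identity of \<open>P\<close>
  along the canonical surjection onto \<open>P\<close> from the free module on the set \<open>carrier P\<close>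
  (finitely supported functions), so \<open>P\<close> is a direct summand of a free module.
\<close>

definition projective_module :: "'a ring \<Rightarrow> ('a, 'p) module \<Rightarrow> bool"
  where "projective_module A P \<longleftrightarrow>
    left_module A P \<and>
    (\<forall>(M :: ('a, 'p \<Rightarrow> 'a) module) (N :: ('a, 'p) module) f g.
       left_module A M \<longrightarrow> left_module A N \<longrightarrow>
       f \<in> mod_hom A M N \<longrightarrow> f ` carrier M = carrier N \<longrightarrow>
       g \<in> mod_hom A P N \<longrightarrow>
       (\<exists>h \<in> mod_hom A P M. \<forall>x\<in>carrier P. f (h x) = g x))"

text \<open>
  Exactness of \<open>\<dots> \<rightarrow> P 2 \<rightarrow> P 1 \<rightarrow> P 0 \<rightarrow> M \<rightarrow> 0\<close>, where \<open>\<delta> n\<close> maps \<open>P (Suc n)\<close> to \<open>P n\<close> and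
  \<open>\<epsilon>\<close> maps \<open>P 0\<close> to \<open>M\<close>.
\<close>

definition projective_resolution ::
  "'a ring \<Rightarrow> (nat \<Rightarrow> ('a, 'p) module) \<Rightarrow> (nat \<Rightarrow> 'p \<Rightarrow> 'p) \<Rightarrow> ('p \<Rightarrow> 'm) \<Rightarrow>
    ('a, 'm) module \<Rightarrow> bool"
  where "projective_resolution A P \<delta> \<epsilon> M \<longleftrightarrow>
    left_module A M \<and>
    (\<forall>n. projective_module A (P n)) \<and>
    (\<forall>n. \<delta> n \<in> mod_hom A (P (Suc n)) (P n)) \<and>
    \<epsilon> \<in> mod_hom A (P 0) M \<and>
    \<epsilon> ` carrier (P 0) = carrier M \<and>
    \<delta> 0 ` carrier (P 1) = {x \<in> carrier (P 0). \<epsilon> x = \<zero>\<^bsub>M\<^esub>} \<and>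
    (\<forall>n. \<delta> (Suc n) ` carrier (P (Suc (Suc n))) = {x \<in> carrier (P (Suc n)). \<delta> n x = \<zero>\<^bsub>P n\<^esub>})"

text \<open>
  \<open>Hom\<^sub>A(M,N)\<close> as a module over a commutative ring \<open>S\<close> via a ring homomorphism \<open>\<eta>\<close> from \<open>S\<close> to the
  centre of \<open>A\<close>.
\<close>

definition Hom_module ::
  "('s \<Rightarrow> 'a) \<Rightarrow> 'a ring \<Rightarrow> ('a, 'm) module \<Rightarrow> ('a, 'n) module \<Rightarrow> ('s, 'm \<Rightarrow> 'n) module"
  where "Hom_module \<eta> A M N =
    \<lparr>carrier = mod_hom A M N, monoid.mult = undefined, one = undefined,
     ring.zero = (\<lambda>x\<in>carrier M. \<zero>\<^bsub>N\<^esub>),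
     add = (\<lambda>f g. \<lambda>x\<in>carrier M. f x \<oplus>\<^bsub>N\<^esub> g x),
     module.smult = (\<lambda>s f. \<lambda>x\<in>carrier M. \<eta> s \<odot>\<^bsub>N\<^esub> f x)\<rparr>"

definition quotient_module :: "('s, 'm) module \<Rightarrow> 'm set \<Rightarrow> ('s, 'm set) module"
  where "quotient_module M U =
    \<lparr>carrier = a_rcosets\<^bsub>M\<^esub> U, monoid.mult = undefined, one = undefined,
     ring.zero = U,
     add = set_add M,
     module.smult = (\<lambda>s C. \<Union>x\<in>C. U +>\<^bsub>M\<^esub> (s \<odot>\<^bsub>M\<^esub> x))\<rparr>"

definition Hom_cocycles ::
  "'a ring \<Rightarrow> (nat \<Rightarrow> ('a, 'p) module) \<Rightarrow> (nat \<Rightarrow> 'p \<Rightarrow> 'p) \<Rightarrow> ('a, 'n) module \<Rightarrow>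
    nat \<Rightarrow> ('p \<Rightarrow> 'n) set"
  where "Hom_cocycles A P \<delta> N i =
    {f \<in> mod_hom A (P i) N. \<forall>x\<in>carrier (P (Suc i)). f (\<delta> i x) = \<zero>\<^bsub>N\<^esub>}"

fun Hom_coboundaries ::
  "'a ring \<Rightarrow> (nat \<Rightarrow> ('a, 'p) module) \<Rightarrow> (nat \<Rightarrow> 'p \<Rightarrow> 'p) \<Rightarrow> ('a, 'n) module \<Rightarrow>
    nat \<Rightarrow> ('p \<Rightarrow> 'n) set"
  where
    "Hom_coboundaries A P \<delta> N 0 = {\<lambda>x\<in>carrier (P 0). \<zero>\<^bsub>N\<^esub>}"
  | "Hom_coboundaries A P \<delta> N (Suc i) =
      (\<lambda>f. \<lambda>x\<in>carrier (P (Suc i)). f (\<delta> i x)) ` mod_hom A (P i) N"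

text \<open>
  \<open>Ext\<^sup>i\<^sub>A(M,N) = H\<^sup>i(Hom\<^sub>A(P,N))\<close>, computed with a given projective resolution \<open>P\<close> of \<open>M\<close>.
  Different resolutions give isomorphic \<open>S\<close>-modules, hence equal annihilators.
\<close>

definition Ext_module ::
  "('s \<Rightarrow> 'a) \<Rightarrow> 'a ring \<Rightarrow> (nat \<Rightarrow> ('a, 'p) module) \<Rightarrow> (nat \<Rightarrow> 'p \<Rightarrow> 'p) \<Rightarrow>
    ('a, 'n) module \<Rightarrow> nat \<Rightarrow> ('s, ('p \<Rightarrow> 'n) set) module"
  where "Ext_module \<eta> A P \<delta> N i =
    quotient_module ((Hom_module \<eta> A (P i) N)\<lparr>carrier := Hom_cocycles A P \<delta> N i\<rparr>)
      (Hom_coboundaries A P \<delta> N i)"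

definition annihilator :: "'s ring \<Rightarrow> ('s, 'm) module \<Rightarrow> 's set"
  where "annihilator S M = {s \<in> carrier S. \<forall>x\<in>carrier M. s \<odot>\<^bsub>M\<^esub> x = \<zero>\<^bsub>M\<^esub>}"

definition ideal_radical :: "'s ring \<Rightarrow> 's set \<Rightarrow> 's set"
  where "ideal_radical S J = {s \<in> carrier S. \<exists>n::nat. s [^]\<^bsub>S\<^esub> n \<in> J}"

definition invariant_ring :: "'r ring \<Rightarrow> 'g monoid \<Rightarrow> ('g \<Rightarrow> 'r \<Rightarrow> 'r) \<Rightarrow> 'r ring"
  where "invariant_ring R G act =
    R\<lparr>carrier := {r \<in> carrier R. \<forall>g\<in>carrier G. act g r = r}\<rparr>"

text \<open>
  The group ring \<open>S[G]\<close> for finite \<open>G\<close>: all functions \<open>G \<rightarrow> S\<close>, with convolution; the function \<open>a\<close>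
  stands for the sum of the \<open>a g \<sqdot> g\<close>.
\<close>

definition group_ring :: "'s ring \<Rightarrow> 'g monoid \<Rightarrow> ('g \<Rightarrow> 's) ring"
  where "group_ring S G =
    \<lparr>carrier = carrier G \<rightarrow>\<^sub>E carrier S,
     monoid.mult = (\<lambda>a b. \<lambda>x\<in>carrier G. \<Oplus>\<^bsub>S\<^esub>y\<in>carrier G. a y \<otimes>\<^bsub>S\<^esub> b (inv\<^bsub>G\<^esub> y \<otimes>\<^bsub>G\<^esub> x)),
     one = (\<lambda>x\<in>carrier G. if x = \<one>\<^bsub>G\<^esub> then \<one>\<^bsub>S\<^esub> else \<zero>\<^bsub>S\<^esub>),
     ring.zero = (\<lambda>x\<in>carrier G. \<zero>\<^bsub>S\<^esub>),
     add = (\<lambda>a b. \<lambda>x\<in>carrier G. a x \<oplus>\<^bsub>S\<^esub> b x)\<rparr>"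

definition group_ring_const :: "'s ring \<Rightarrow> 'g monoid \<Rightarrow> 's \<Rightarrow> 'g \<Rightarrow> 's"
  where "group_ring_const S G s = (\<lambda>x\<in>carrier G. if x = \<one>\<^bsub>G\<^esub> then s else \<zero>\<^bsub>S\<^esub>)"

text \<open>
  A ring \<open>R\<close> with \<open>G\<close>-action as an \<open>S[G]\<close>-module, for a subring \<open>S\<close> of the invariants:
  \<open>(\<Sum> a g \<sqdot> g) \<odot> r = \<Sum> a g * (g \<sqdot> r)\<close>.
\<close>

definition action_module ::
  "'r ring \<Rightarrow> 'g monoid \<Rightarrow> ('g \<Rightarrow> 'r \<Rightarrow> 'r) \<Rightarrow> ('g \<Rightarrow> 'r, 'r) module"
  where "action_module R G act =
    \<lparr>carrier = carrier R, monoid.mult = monoid.mult R, one = monoid.one R,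
     ring.zero = ring.zero R, add = ring.add R,
     module.smult = (\<lambda>a r. \<Oplus>\<^bsub>R\<^esub>g\<in>carrier G. a g \<otimes>\<^bsub>R\<^esub> act g r)\<rparr>"

definition trivial_module :: "'s ring \<Rightarrow> 'g monoid \<Rightarrow> ('g \<Rightarrow> 's, 's) module"
  where "trivial_module S G = action_module S G (\<lambda>g s. s)"

text \<open>
  \<open>H\<^sup>i(G,N) = Ext\<^sup>i\<close> over \<open>S[G]\<close> from the trivial module \<open>S\<close> to \<open>N\<close>, as an \<open>S\<close>-module; \<open>P\<close> is a projective
  resolution of the trivial module.
\<close>

definition group_cohomology ::
  "'s ring \<Rightarrow> 'g monoid \<Rightarrow> (nat \<Rightarrow> ('g \<Rightarrow> 's, 'p) module) \<Rightarrow> (nat \<Rightarrow> 'p \<Rightarrow> 'p) \<Rightarrow>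
    ('g \<Rightarrow> 's, 'n) module \<Rightarrow> nat \<Rightarrow> ('s, ('p \<Rightarrow> 'n) set) module"
  where "group_cohomology S G P \<delta> N i =
    Ext_module (group_ring_const S G) (group_ring S G) P \<delta> N i"

definition GL :: "('k::field \<Rightarrow> 'v::ab_group_add \<Rightarrow> 'v) \<Rightarrow> ('v \<Rightarrow> 'v) monoid"
  where "GL scale =
    \<lparr>carrier = {g. Vector_Spaces.linear scale scale g \<and> bij g}, monoid.mult = (\<circ>), one = id\<rparr>"

definition dual_space :: "('k::field \<Rightarrow> 'v::ab_group_add \<Rightarrow> 'v) \<Rightarrow> ('v \<Rightarrow> 'k) set"
  where "dual_space scale = {\<phi>. Vector_Spaces.linear scale (*) \<phi>}"

definition dual_act :: "('v \<Rightarrow> 'v) \<Rightarrow> ('v \<Rightarrow> 'k) \<Rightarrow> 'v \<Rightarrow> 'k"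
  where "dual_act g \<phi> = \<phi> \<circ> inv_into UNIV g"

text \<open>Polynomials over \<open>'k\<close> in indeterminates indexed by \<open>'x\<close>; the keys are the monomials.\<close>

type_synonym ('x, 'k) mpoly = "('x \<Rightarrow>\<^sub>0 nat) \<Rightarrow>\<^sub>0 'k"

definition pconst :: "'k::comm_ring_1 \<Rightarrow> ('x, 'k) mpoly"
  where "pconst c = Poly_Mapping.single 0 c"

definition pvar :: "'x \<Rightarrow> ('x, 'k::comm_ring_1) mpoly"
  where "pvar x = Poly_Mapping.single (Poly_Mapping.single x 1) 1"

definition psubst :: "('x \<Rightarrow> ('y, 'k::comm_ring_1) mpoly) \<Rightarrow> ('x, 'k) mpoly \<Rightarrow> ('y, 'k) mpoly"
  where "psubst f p =
    (\<Sum>m\<in>Poly_Mapping.keys p. pconst (Poly_Mapping.lookup p m) *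
       (\<Prod>x\<in>Poly_Mapping.keys m. f x ^ Poly_Mapping.lookup m x))"

definition mvpoly_ring :: "'x set \<Rightarrow> ('x, 'k::comm_ring_1) mpoly ring"
  where "mvpoly_ring I =
    ring_of_type_algebra
      \<lparr>carrier := {p. \<forall>m\<in>Poly_Mapping.keys p. Poly_Mapping.keys m \<subseteq> I}\<rparr>"

definition dual_relations ::
  "('k::field \<Rightarrow> 'v::ab_group_add \<Rightarrow> 'v) \<Rightarrow> ('v \<Rightarrow> 'k, 'k) mpoly set"
  where "dual_relations scale =
    {pvar (\<lambda>v. \<phi> v + \<psi> v) - (pvar \<phi> + pvar \<psi>) |\<phi> \<psi>.
        \<phi> \<in> dual_space scale \<and> \<psi> \<in> dual_space scale} \<union>
    {pvar (\<lambda>v. c * \<phi> v) - pconst c * pvar \<phi> |c \<phi>. \<phi> \<in> dual_space scale}"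

definition dual_relations_ideal ::
  "('k::field \<Rightarrow> 'v::ab_group_add \<Rightarrow> 'v) \<Rightarrow> ('v \<Rightarrow> 'k, 'k) mpoly set"
  where "dual_relations_ideal scale =
    Idl\<^bsub>mvpoly_ring (dual_space scale)\<^esub> (dual_relations scale)"

text \<open>
  \<open>Sym(V\<^sup>*)\<close>: the commutative algebra generated by symbols for the elements of \<open>V\<^sup>*\<close>, modulo the
  relations that make the symbols depend linearly on those elements.
\<close>

definition coordinate_ring ::
  "('k::field \<Rightarrow> 'v::ab_group_add \<Rightarrow> 'v) \<Rightarrow> ('v \<Rightarrow> 'k, 'k) mpoly set ring"
  where "coordinate_ring scale =
    mvpoly_ring (dual_space scale) Quot dual_relations_ideal scale"

definition linear_form ::
  "('k::field \<Rightarrow> 'v::ab_group_add \<Rightarrow> 'v) \<Rightarrow> ('v \<Rightarrow> 'k) \<Rightarrow> ('v \<Rightarrow> 'k, 'k) mpoly set"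
  where "linear_form scale \<phi> =
    dual_relations_ideal scale +>\<^bsub>mvpoly_ring (dual_space scale)\<^esub> pvar \<phi>"

text \<open>
  The algebra automorphism of \<open>Sym(V\<^sup>*)\<close> induced by \<open>g\<close>. The substitution permutes the
  defining relations, so the image of a coset is again a coset.
\<close>

definition coordinate_act ::
  "('v \<Rightarrow> 'v) \<Rightarrow> ('v \<Rightarrow> 'k, 'k::field) mpoly set \<Rightarrow> ('v \<Rightarrow> 'k, 'k) mpoly set"
  where "coordinate_act g C = psubst (\<lambda>\<phi>. pvar (dual_act g \<phi>)) ` C"

definition top_dickson ::
  "('k::field \<Rightarrow> 'v::ab_group_add \<Rightarrow> 'v) \<Rightarrow> ('v \<Rightarrow> 'k, 'k) mpoly set"
  where "top_dickson scale =
    (\<Otimes>\<^bsub>coordinate_ring scale\<^esub>\<phi>\<in>dual_space scale - {\<lambda>v. 0}. linear_form scale \<phi>)"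

end

theory Submission
  imports Defs
begin

text \<open>
  For \<open>r \<in> R\<close> let \<open>tr r = \<Sum>\<^bsub>g\<in>G\<^esub> g r\<close> be its transfer. Two facts give the theorem: every transfer
  annihilates the cohomology of \<open>R\<close> in positive degrees, and some power of the top Dickson class
  is a transfer.

  The first holds because a projective resolution of the trivial \<open>S[G]\<close>-module \<open>S\<close> consists of
  modules that are projective over \<open>S\<close> and resolves a free \<open>S\<close>-module, so that it splits over \<open>S\<close>
  (\<open>resolution_splits_over_scalars\<close>). A cocycle \<open>f\<close> is therefore \<open>f \<circ> s \<circ> \<delta>\<close> for an \<open>S\<close>-linear map
  \<open>s\<close>. Averaging \<open>r * (f \<circ> s)\<close> over \<open>G\<close> yields an \<open>S[G]\<close>-linear map with coboundary \<open>tr r * f\<close>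
  (\<open>transfer_cocycle_coboundary\<close>).

  The second is the algebraic form of the statement that \<open>G\<close> acts freely where the Dickson class
  \<open>d\<close> does not vanish. Every \<open>g \<noteq> 1\<close> in \<open>G\<close> moves some linear form \<open>v\<^sub>g\<close>. Then \<open>v\<^sub>g - g v\<^sub>g\<close> is a
  nonzero linear form, hence \<open>d = (v\<^sub>g - g v\<^sub>g) e\<^sub>g\<close> for some \<open>e\<^sub>g\<close>. In the sum over \<open>h \<in> G\<close> of the
  products \<open>\<Prod>\<^bsub>g\<noteq>1\<^esub> (h v\<^sub>g - g v\<^sub>g) e\<^sub>g\<close> only the term for \<open>h = 1\<close> survives, because any other
  product has the factor with \<open>g = h\<close>; so the sum is \<open>d ^ (|G| - 1)\<close>. Expanding the products one
  factor at a time shows on the other hand that the sum is an \<open>R\<close>-linear combination of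
  transfers. The transfers form an ideal of \<open>S\<close>, not of \<open>R\<close>, so the coefficients have to be made
  invariant. This is achieved by taking the product over the \<open>G\<close>-orbit: the orbit product of
  \<open>\<Sum> x\<^sub>i t\<^sub>i\<close> with invariant \<open>t\<^sub>i\<close> is a polynomial in the \<open>t\<^sub>i\<close> without constant term and with
  invariant coefficients (\<open>orbit_prod_add_mult_invariant\<close>). Since \<open>d\<close> is invariant, the orbit product
  of \<open>d ^ (|G| - 1)\<close> is again a power of \<open>d\<close>, and it is a transfer (\<open>power_congruent_trace\<close>).

  The second argument takes place in the polynomial ring of which the coordinate ring is a
  quotient, with equations replaced by congruences modulo the ideal of relations.
\<close>

section \<open>Linear maps and projective modules\<close>

text \<open>
  Linearity over a subset \<open>T\<close> of the base ring interpolates between additive maps (\<open>T = {}\<close>), maps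
  linear over a subring, and module homomorphisms. Unlike \<open>mod_hom\<close> it does not ask for
  extensionality, so that compositions and differences need no restriction.
\<close>

definition linear_over :: "'a set \<Rightarrow> ('a, 'm, 'x) module_scheme \<Rightarrow> ('a, 'n, 'y) module_scheme \<Rightarrow> ('m \<Rightarrow> 'n) \<Rightarrow> bool"
  where "linear_over T M N f \<longleftrightarrow>
    f \<in> carrier M \<rightarrow> carrier N \<and>
    (\<forall>x\<in>carrier M. \<forall>y\<in>carrier M. f (x \<oplus>\<^bsub>M\<^esub> y) = f x \<oplus>\<^bsub>N\<^esub> f y) \<and>
    (\<forall>t\<in>T. \<forall>x\<in>carrier M. f (t \<odot>\<^bsub>M\<^esub> x) = t \<odot>\<^bsub>N\<^esub> f x)"

lemma linear_overI:
  assumes "\<And>x. x \<in> carrier M \<Longrightarrow> f x \<in> carrier N"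
    and "\<And>x y. x \<in> carrier M \<Longrightarrow> y \<in> carrier M \<Longrightarrow> f (x \<oplus>\<^bsub>M\<^esub> y) = f x \<oplus>\<^bsub>N\<^esub> f y"
    and "\<And>t x. t \<in> T \<Longrightarrow> x \<in> carrier M \<Longrightarrow> f (t \<odot>\<^bsub>M\<^esub> x) = t \<odot>\<^bsub>N\<^esub> f x"
  shows "linear_over T M N f"
  using assms by (auto simp: linear_over_def)

lemma linear_overD:
  assumes "linear_over T M N f"
  shows linear_over_closed: "\<And>x. x \<in> carrier M \<Longrightarrow> f x \<in> carrier N"
    and linear_over_add: "\<And>x y. x \<in> carrier M \<Longrightarrow> y \<in> carrier M \<Longrightarrow> f (x \<oplus>\<^bsub>M\<^esub> y) = f x \<oplus>\<^bsub>N\<^esub> f y"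
    and linear_over_smult: "\<And>t x. t \<in> T \<Longrightarrow> x \<in> carrier M \<Longrightarrow> f (t \<odot>\<^bsub>M\<^esub> x) = t \<odot>\<^bsub>N\<^esub> f x"
  using assms by (auto simp: linear_over_def)

lemma mod_hom_linear_over: "f \<in> mod_hom A M N \<Longrightarrow> T \<subseteq> carrier A \<Longrightarrow> linear_over T M N f"
  by (auto simp: mod_hom_def linear_over_def)

lemma linear_over_compose:
  assumes "linear_over T L M f" "linear_over T M N g"
  shows "linear_over T L N (\<lambda>x. g (f x))"
  using assms by (auto simp: linear_over_def Pi_iff)

lemma linear_over_zero:
  assumes "abelian_group M" "abelian_group N" "linear_over T M N f"
  shows "f \<zero>\<^bsub>M\<^esub> = \<zero>\<^bsub>N\<^esub>"
proof -
  interpret M: abelian_group M by fact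
  interpret N: abelian_group N by fact
  have "f \<zero>\<^bsub>M\<^esub> = f \<zero>\<^bsub>M\<^esub> \<oplus>\<^bsub>N\<^esub> f \<zero>\<^bsub>M\<^esub>"
    using linear_over_add[OF assms(3) M.zero_closed M.zero_closed] by simp
  then show ?thesis
    using linear_over_closed[OF assms(3) M.zero_closed] by (metis N.add.l_cancel_one')
qed

lemma linear_over_minus:
  assumes "abelian_group M" "abelian_group N" "linear_over T M N f" "x \<in> carrier M"
  shows "f (\<ominus>\<^bsub>M\<^esub> x) = \<ominus>\<^bsub>N\<^esub> f x"
proof -
  interpret M: abelian_group M by fact
  interpret N: abelian_group N by fact
  have "f (\<ominus>\<^bsub>M\<^esub> x) \<oplus>\<^bsub>N\<^esub> f x = \<zero>\<^bsub>N\<^esub>"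
    using linear_over_add[OF assms(3), of "\<ominus>\<^bsub>M\<^esub> x" x] assms(4)
      linear_over_zero[OF assms(1-3)] by (simp add: M.l_neg)
  then show ?thesis
    using linear_over_closed[OF assms(3)] assms(4) by (metis M.a_inv_closed N.minus_equality)
qed

lemma linear_over_finsum:
  assumes "abelian_group M" "abelian_group N" "linear_over T M N f"
    and "\<And>b. b \<in> B \<Longrightarrow> g b \<in> carrier M"
  shows "f (finsum M g B) = finsum N (\<lambda>b. f (g b)) B"
proof -
  interpret M: abelian_group M by fact
  interpret N: abelian_group N by fact
  note f = linear_over_closed[OF assms(3)] linear_over_add[OF assms(3)]
  show ?thesis
    using assms(4)
  proof (induction B rule: infinite_finite_induct)
    case (insert b B)
    then show ?case
      by (subst M.finsum_insert N.finsum_insert; force simp: f Pi_iff)+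
  qed (use linear_over_zero[OF assms(1-3)] in auto)
qed

lemma linear_over_diff:
  assumes N: "left_module A N" and T: "T \<subseteq> carrier A"
    and f: "linear_over T M N f" and g: "linear_over T M N g"
  shows "linear_over T M N (\<lambda>x. f x \<ominus>\<^bsub>N\<^esub> g x)"
proof -
  interpret N: left_module A N by fact
  note cl = linear_over_closed[OF f] linear_over_closed[OF g]
  have neg: "t \<odot>\<^bsub>N\<^esub> (\<ominus>\<^bsub>N\<^esub> y) = \<ominus>\<^bsub>N\<^esub> (t \<odot>\<^bsub>N\<^esub> y)" if "t \<in> T" "y \<in> carrier N" for t y
  proof (rule linear_over_minus)
    show "linear_over {} N N (\<lambda>y. t \<odot>\<^bsub>N\<^esub> y)"
      by (rule linear_overI) (use that T N.lsmult_closed N.lsmult_r_distr in auto)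
  qed (use that N.M.abelian_group_axioms in auto)
  show ?thesis
  proof (rule linear_overI)
    fix x y assume "x \<in> carrier M" "y \<in> carrier M"
    then show "f (x \<oplus>\<^bsub>M\<^esub> y) \<ominus>\<^bsub>N\<^esub> g (x \<oplus>\<^bsub>M\<^esub> y) = (f x \<ominus>\<^bsub>N\<^esub> g x) \<oplus>\<^bsub>N\<^esub> (f y \<ominus>\<^bsub>N\<^esub> g y)"
      using cl by (simp add: linear_over_add[OF f] linear_over_add[OF g] a_minus_def N.M.minus_add N.M.a_ac)
  next
    fix t x assume "t \<in> T" "x \<in> carrier M"
    then show "f (t \<odot>\<^bsub>M\<^esub> x) \<ominus>\<^bsub>N\<^esub> g (t \<odot>\<^bsub>M\<^esub> x) = t \<odot>\<^bsub>N\<^esub> (f x \<ominus>\<^bsub>N\<^esub> g x)"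
      using cl T neg by (simp add: linear_over_smult[OF f] linear_over_smult[OF g] a_minus_def
          N.lsmult_r_distr subset_iff)
  qed (simp add: cl)
qed

definition regular_module :: "'a ring \<Rightarrow> ('a, 'a) module"
  where "regular_module A =
    \<lparr>carrier = carrier A, monoid.mult = monoid.mult A, one = one A,
     ring.zero = ring.zero A, add = add A, module.smult = monoid.mult A\<rparr>"

lemma left_module_regular:
  fixes A :: "'a ring" (structure)
  assumes "ring A"
  shows "left_module A (regular_module A)"
proof -
  interpret ring A by fact
  have "abelian_group (regular_module A)"
  proof (rule abelian_groupI)
    fix x assume "x \<in> carrier (regular_module A)"
    then show "\<exists>y\<in>carrier (regular_module A). y \<oplus>\<^bsub>regular_module A\<^esub> x = \<zero>\<^bsub>regular_module A\<^esub>"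
      by (intro bexI[of _ "\<ominus> x"]) (auto simp: regular_module_def l_neg)
  qed (auto simp: regular_module_def a_ac)
  then show ?thesis
    by (intro left_module.intro left_module_axioms.intro ring_axioms)
      (auto simp: regular_module_def l_distr r_distr m_assoc)
qed

lemma finsum_regular_module: "finsum (regular_module A) f B = finsum A f B"
  by (simp add: finsum_def finprod_def regular_module_def)

definition free_module :: "'a ring \<Rightarrow> 'x set \<Rightarrow> ('a, 'x \<Rightarrow> 'a) module"
  where "free_module A I =
    \<lparr>carrier = {\<phi> \<in> I \<rightarrow>\<^sub>E carrier A. finite {x\<in>I. \<phi> x \<noteq> \<zero>\<^bsub>A\<^esub>}},
     monoid.mult = undefined, one = undefined,
     ring.zero = (\<lambda>x\<in>I. \<zero>\<^bsub>A\<^esub>),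
     add = (\<lambda>\<phi> \<psi>. \<lambda>x\<in>I. \<phi> x \<oplus>\<^bsub>A\<^esub> \<psi> x),
     module.smult = (\<lambda>a \<phi>. \<lambda>x\<in>I. a \<otimes>\<^bsub>A\<^esub> \<phi> x)\<rparr>"

lemma left_module_free:
  fixes A :: "'a ring" (structure) and I :: "'x set"
  assumes "ring A"
  shows "left_module A (free_module A I)"
proof -
  interpret ring A by fact
  have add_fin: "finite {x\<in>I. \<phi> x \<oplus> \<psi> x \<noteq> \<zero>}"
    if "finite {x\<in>I. \<phi> x \<noteq> \<zero>}" "finite {x\<in>I. \<psi> x \<noteq> \<zero>}" for \<phi> \<psi> :: "'x \<Rightarrow> 'a"
    by (rule finite_subset[OF _ finite_UnI[OF that]]) auto
  have smult_fin: "finite {x\<in>I. a \<otimes> \<phi> x \<noteq> \<zero>}"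
    if "finite {x\<in>I. \<phi> x \<noteq> \<zero>}" "a \<in> carrier A" for a and \<phi> :: "'x \<Rightarrow> 'a"
    by (rule finite_subset[OF _ that(1)]) (use that(2) in auto)
  have "abelian_group (free_module A I)"
  proof (rule abelian_groupI)
    fix \<phi> assume \<phi>: "\<phi> \<in> carrier (free_module A I)"
    show "\<exists>\<psi>\<in>carrier (free_module A I). \<psi> \<oplus>\<^bsub>free_module A I\<^esub> \<phi> = \<zero>\<^bsub>free_module A I\<^esub>"
      by (rule bexI[of _ "\<lambda>x\<in>I. \<ominus> \<phi> x"])
        (use \<phi> in \<open>auto simp: free_module_def PiE_iff l_neg
            intro: rev_finite_subset[of "{x\<in>I. \<phi> x \<noteq> \<zero>}"]\<close>)
  qed (auto simp: free_module_def PiE_iff a_ac add_fin extensional_def fun_eq_iff cong: conj_cong)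
  then show ?thesis
    by (intro left_module.intro left_module_axioms.intro ring_axioms)
      (auto simp: free_module_def PiE_iff l_distr r_distr m_assoc smult_fin extensional_def fun_eq_iff
         cong: conj_cong)
qed

text \<open>
  The map out of a free module that is given on the summand of index \<open>x\<close> by \<open>w x\<close>. The maps \<open>w x\<close> are
  allowed to be linear over a subset of the ring only, so their values at \<open>1\<close> do not determine them.
\<close>

definition free_extension ::
  "'a ring \<Rightarrow> 'x set \<Rightarrow> ('a, 'm, 'y) module_scheme \<Rightarrow> ('x \<Rightarrow> 'a \<Rightarrow> 'm) \<Rightarrow> ('x \<Rightarrow> 'a) \<Rightarrow> 'm"
  where "free_extension A I M w \<phi> = (\<Oplus>\<^bsub>M\<^esub>x\<in>{x\<in>I. \<phi> x \<noteq> \<zero>\<^bsub>A\<^esub>}. w x (\<phi> x))"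

text \<open>
  Two elements of the free module have different supports; their values under the extension can be
  added only after both sums are taken over a common finite index set.
\<close>

lemma free_extension_superset:
  assumes A: "ring A" and M: "abelian_group M"
    and w: "\<And>x. x \<in> I \<Longrightarrow> linear_over T (regular_module A) M (w x)"
    and \<phi>: "\<phi> \<in> carrier (free_module A I)"
    and B: "finite B" "{x\<in>I. \<phi> x \<noteq> \<zero>\<^bsub>A\<^esub>} \<subseteq> B" "B \<subseteq> I"
  shows "free_extension A I M w \<phi> = (\<Oplus>\<^bsub>M\<^esub>x\<in>B. w x (\<phi> x))"
proof -
  interpret M: abelian_group M by fact
  interpret A: ring A by fact
  have "abelian_group (regular_module A)"
    using left_module_regular[OF A.ring_axioms] by (simp add: left_module_def)
  then have 0: "w x \<zero>\<^bsub>A\<^esub> = \<zero>\<^bsub>M\<^esub>" if "x \<in> I" for x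
    using linear_over_zero[OF _ M w[OF that]] by (simp add: regular_module_def)
  have cl: "w x (\<phi> x) \<in> carrier M" if "x \<in> I" for x
    using linear_over_closed[OF w[OF that]] \<phi> that by (auto simp: regular_module_def free_module_def)
  show ?thesis
    unfolding free_extension_def
    by (rule M.add.finprod_mono_neutral_cong_left[OF B(1,2), folded finsum_def])
      (use 0 cl B in auto)
qed

lemma linear_over_free_extension:
  assumes A: "ring A" and M: "left_module A M" and T: "T \<subseteq> carrier A"
    and w: "\<And>x. x \<in> I \<Longrightarrow> linear_over T (regular_module A) M (w x)"
  shows "linear_over T (free_module A I) M (free_extension A I M w)"
proof -
  interpret A: ring A by fact
  interpret M: left_module A M by fact
  interpret F: left_module A "free_module A I" by (rule left_module_free[OF A.ring_axioms])
  have Mg: "abelian_group M" by (rule M.M.abelian_group_axioms)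
  let ?supp = "\<lambda>\<phi>. {x\<in>I. \<phi> x \<noteq> \<zero>\<^bsub>A\<^esub>}"
  have wc: "w x a \<in> carrier M" if "x \<in> I" "a \<in> carrier A" for x a
    using linear_over_closed[OF w[OF that(1)]] that(2) by (simp add: regular_module_def)
  have wa: "w x (a \<oplus>\<^bsub>A\<^esub> b) = w x a \<oplus>\<^bsub>M\<^esub> w x b" if "x \<in> I" "a \<in> carrier A" "b \<in> carrier A" for x a b
    using linear_over_add[OF w[OF that(1)]] that by (simp add: regular_module_def)
  have ws: "w x (t \<otimes>\<^bsub>A\<^esub> a) = t \<odot>\<^bsub>M\<^esub> w x a" if "x \<in> I" "a \<in> carrier A" "t \<in> T" for x a t
    using linear_over_smult[OF w[OF that(1)]] that by (simp add: regular_module_def)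
  have val: "\<phi> x \<in> carrier A" if "\<phi> \<in> carrier (free_module A I)" "x \<in> I" for \<phi> x
    using that by (auto simp: free_module_def)
  have fin: "finite (?supp \<phi>)" if "\<phi> \<in> carrier (free_module A I)" for \<phi>
    using that by (auto simp: free_module_def)
  note ext = free_extension_superset[where w = w, OF A Mg w]
  show ?thesis
  proof (rule linear_overI)
    fix \<phi> assume "\<phi> \<in> carrier (free_module A I)"
    then show "free_extension A I M w \<phi> \<in> carrier M"
      unfolding free_extension_def by (intro M.M.finsum_closed) (auto intro: wc val)
  next
    fix \<phi> \<psi> assume \<phi>: "\<phi> \<in> carrier (free_module A I)" and \<psi>: "\<psi> \<in> carrier (free_module A I)"
    let ?B = "?supp \<phi> \<union> ?supp \<psi>"
    have s: "\<phi> \<oplus>\<^bsub>free_module A I\<^esub> \<psi> \<in> carrier (free_module A I)"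
      using \<phi> \<psi> by (rule F.M.a_closed)
    have B: "finite ?B" "?B \<subseteq> I" using fin \<phi> \<psi> by auto
    have "free_extension A I M w (\<phi> \<oplus>\<^bsub>free_module A I\<^esub> \<psi>)
        = (\<Oplus>\<^bsub>M\<^esub>x\<in>?B. w x ((\<phi> \<oplus>\<^bsub>free_module A I\<^esub> \<psi>) x))"
      by (rule ext[OF _ s]) (use B in \<open>auto simp: free_module_def\<close>)
    also have "\<dots> = (\<Oplus>\<^bsub>M\<^esub>x\<in>?B. w x (\<phi> x) \<oplus>\<^bsub>M\<^esub> w x (\<psi> x))"
      by (rule M.M.finsum_cong') (auto simp: free_module_def val[OF \<phi>, unfolded free_module_def]
          val[OF \<psi>, unfolded free_module_def] intro!: wa wc val \<phi> \<psi>)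
    also have "\<dots> = (\<Oplus>\<^bsub>M\<^esub>x\<in>?B. w x (\<phi> x)) \<oplus>\<^bsub>M\<^esub> (\<Oplus>\<^bsub>M\<^esub>x\<in>?B. w x (\<psi> x))"
      by (rule M.M.finsum_addf) (auto intro!: wc val \<phi> \<psi>)
    also have "\<dots> = free_extension A I M w \<phi> \<oplus>\<^bsub>M\<^esub> free_extension A I M w \<psi>"
      using ext[OF _ \<phi> B(1)] ext[OF _ \<psi> B(1)] B(2) by simp
    finally show "free_extension A I M w (\<phi> \<oplus>\<^bsub>free_module A I\<^esub> \<psi>)
        = free_extension A I M w \<phi> \<oplus>\<^bsub>M\<^esub> free_extension A I M w \<psi>" .
  next
    fix t \<phi> assume t: "t \<in> T" and \<phi>: "\<phi> \<in> carrier (free_module A I)"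
    have tA: "t \<in> carrier A" using t T by auto
    have s: "t \<odot>\<^bsub>free_module A I\<^esub> \<phi> \<in> carrier (free_module A I)"
      using tA \<phi> by (rule F.lsmult_closed)
    have lin: "linear_over {} M M (\<lambda>y. t \<odot>\<^bsub>M\<^esub> y)"
      by (rule linear_overI) (use tA M.lsmult_closed M.lsmult_r_distr in auto)
    have "free_extension A I M w (t \<odot>\<^bsub>free_module A I\<^esub> \<phi>)
        = (\<Oplus>\<^bsub>M\<^esub>x\<in>?supp \<phi>. w x ((t \<odot>\<^bsub>free_module A I\<^esub> \<phi>) x))"
      by (rule ext[OF _ s]) (use fin \<phi> tA in \<open>auto simp: free_module_def\<close>)
    also have "\<dots> = (\<Oplus>\<^bsub>M\<^esub>x\<in>?supp \<phi>. t \<odot>\<^bsub>M\<^esub> w x (\<phi> x))"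
      by (rule M.M.finsum_cong') (auto simp: free_module_def intro!: ws M.lsmult_closed wc val \<phi> t tA)
    also have "\<dots> = t \<odot>\<^bsub>M\<^esub> free_extension A I M w \<phi>"
      unfolding free_extension_def
      by (rule linear_over_finsum[OF Mg Mg lin, symmetric]) (auto intro: wc val \<phi>)
    finally show "free_extension A I M w (t \<odot>\<^bsub>free_module A I\<^esub> \<phi>)
        = t \<odot>\<^bsub>M\<^esub> free_extension A I M w \<phi>" .
  qed
qed

text \<open>
  The lifting property, applied to the canonical surjection from the free module on the elements of
  \<open>P\<close>, exhibits \<open>P\<close> as a direct summand of that free module.
\<close>

lemma projective_module_free_section:
  fixes P :: "('a, 'p) module"
  assumes "projective_module A P"
  obtains h where "h \<in> mod_hom A P (free_module A (carrier P))"
    and "\<And>x. x \<in> carrier P \<Longrightarrow>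
      free_extension A (carrier P) P (\<lambda>y a. a \<odot>\<^bsub>P\<^esub> y) (h x) = x"
proof -
  have P: "left_module A P" and
    lift: "\<And>(M :: ('a, 'p \<Rightarrow> 'a) module) (N :: ('a, 'p) module) f g.
       left_module A M \<Longrightarrow> left_module A N \<Longrightarrow> f \<in> mod_hom A M N \<Longrightarrow> f ` carrier M = carrier N \<Longrightarrow>
       g \<in> mod_hom A P N \<Longrightarrow> \<exists>h \<in> mod_hom A P M. \<forall>x\<in>carrier P. f (h x) = g x"
    using assms unfolding projective_module_def by blast+
  interpret P: left_module A P by fact
  have A: "ring A" by (rule P.A.ring_axioms)
  let ?F = "free_module A (carrier P)"
  let ?e = "free_extension A (carrier P) P (\<lambda>y a. a \<odot>\<^bsub>P\<^esub> y)"
  have F: "left_module A ?F" by (rule left_module_free[OF P.A.ring_axioms])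
  have wl: "linear_over (carrier A) (regular_module A) P (\<lambda>a. a \<odot>\<^bsub>P\<^esub> y)" if "y \<in> carrier P" for y
    by (rule linear_overI)
      (use that P.lsmult_closed P.lsmult_l_distr P.lsmult_assoc in \<open>auto simp: regular_module_def\<close>)
  have e: "linear_over (carrier A) ?F P ?e"
    by (rule linear_over_free_extension[OF A P _ wl]) auto
  have F_add: "x \<oplus>\<^bsub>?F\<^esub> y \<in> carrier ?F" if "x \<in> carrier ?F" "y \<in> carrier ?F" for x y
    using F that by (meson abelian_monoid.a_closed abelian_group_def left_module_def)
  have F_smult: "a \<odot>\<^bsub>?F\<^esub> y \<in> carrier ?F" if "a \<in> carrier A" "y \<in> carrier ?F" for a y
    using F that by (rule left_module.lsmult_closed)
  have hom: "restrict ?e (carrier ?F) \<in> mod_hom A ?F P"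
    using linear_overD[OF e] F_add F_smult by (simp add: mod_hom_def)
  have surj: "\<exists>\<phi>\<in>carrier ?F. ?e \<phi> = x" if x: "x \<in> carrier P" for x
  proof -
    \<comment> \<open>the basis vector with index \<open>x\<close>\<close>
    let ?\<phi> = "\<lambda>y\<in>carrier P. if y = x then \<one>\<^bsub>A\<^esub> else \<zero>\<^bsub>A\<^esub>"
    have \<phi>: "?\<phi> \<in> carrier ?F"
      by (auto simp: free_module_def intro: finite_subset[of _ "{x}"])
    have "?e ?\<phi> = (\<Oplus>\<^bsub>P\<^esub>y\<in>{x}. ?\<phi> y \<odot>\<^bsub>P\<^esub> y)"
      by (rule free_extension_superset[OF A P.M.abelian_group_axioms wl \<phi>]) (use x in auto)
    also have "\<dots> = x"
      using x by (subst P.M.finsum_insert) (auto simp: P.lsmult_one)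
    finally show ?thesis using \<phi> by blast
  qed
  have im: "restrict ?e (carrier ?F) ` carrier ?F = carrier P"
    using linear_over_closed[OF e] surj by force
  have id: "(\<lambda>x\<in>carrier P. x) \<in> mod_hom A P P"
    by (auto simp: mod_hom_def P.lsmult_closed)
  obtain h where h: "h \<in> mod_hom A P ?F"
    and eh: "\<And>x. x \<in> carrier P \<Longrightarrow> restrict ?e (carrier ?F) (h x) = x"
    using lift[OF F P hom im id] by auto
  show thesis
  proof (rule that[OF h])
    fix x assume x: "x \<in> carrier P"
    then have "h x \<in> carrier ?F" using h by (auto simp: mod_hom_def)
    then show "?e (h x) = x" using eh[OF x] by simp
  qed
qed

text \<open>
  As \<open>P\<close> is a summand of a free module, a lifting problem for \<open>T\<close>-linear maps out of \<open>P\<close> reduces to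
  one for each free summand. In contrast to the defining property, the lift is sought along an
  additive map \<open>\<delta>\<close>, it only has to be \<open>T\<close>-linear, and \<open>M\<close> and \<open>N\<close> may live on any types.
\<close>

lemma projective_module_lift:
  fixes P :: "('a, 'p) module"
  assumes P: "projective_module A P" and T: "T \<subseteq> carrier A"
    and M: "left_module A M" and N: "left_module A N"
    and \<delta>: "linear_over {} M N \<delta>" and u: "linear_over {} P N u"
    and cyc: "\<And>y. y \<in> carrier P \<Longrightarrow> \<exists>w. linear_over T (regular_module A) M w \<and>
                 (\<forall>a\<in>carrier A. \<delta> (w a) = u (a \<odot>\<^bsub>P\<^esub> y))"
  obtains s where "linear_over T P M s" "\<And>x. x \<in> carrier P \<Longrightarrow> \<delta> (s x) = u x"
proof -
  obtain h where h: "h \<in> mod_hom A P (free_module A (carrier P))"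
    and eh: "\<And>x. x \<in> carrier P \<Longrightarrow>
      free_extension A (carrier P) P (\<lambda>y a. a \<odot>\<^bsub>P\<^esub> y) (h x) = x"
    using projective_module_free_section[OF P] by blast
  have "left_module A P" using P by (simp add: projective_module_def)
  then interpret P: left_module A P .
  interpret M: left_module A M by fact
  interpret N: left_module A N by fact
  have A: "ring A" by (rule P.A.ring_axioms)
  obtain w where w: "\<And>y. y \<in> carrier P \<Longrightarrow> linear_over T (regular_module A) M (w y)"
    and \<delta>w: "\<And>y a. y \<in> carrier P \<Longrightarrow> a \<in> carrier A \<Longrightarrow> \<delta> (w y a) = u (a \<odot>\<^bsub>P\<^esub> y)"
    using cyc by metis
  \<comment> \<open>lift the coordinates of \<open>x\<close> separately\<close>
  let ?s = "\<lambda>x. free_extension A (carrier P) M w (h x)"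
  show thesis
  proof (rule that)
    show "linear_over T P M ?s"
      by (rule linear_over_compose[OF mod_hom_linear_over[OF h T] linear_over_free_extension[OF A M T w]])
    fix x assume x: "x \<in> carrier P"
    have hx: "h x y \<in> carrier A" if "y \<in> carrier P" for y
      using h x that by (auto simp: mod_hom_def free_module_def)
    let ?B = "{y\<in>carrier P. h x y \<noteq> \<zero>\<^bsub>A\<^esub>}"
    have "\<delta> (?s x) = (\<Oplus>\<^bsub>N\<^esub>y\<in>?B. \<delta> (w y (h x y)))"
      unfolding free_extension_def
      by (rule linear_over_finsum[OF M.M.abelian_group_axioms N.M.abelian_group_axioms \<delta>])
        (use linear_over_closed[OF w] hx in \<open>auto simp: regular_module_def\<close>)
    also have "\<dots> = (\<Oplus>\<^bsub>N\<^esub>y\<in>?B. u (h x y \<odot>\<^bsub>P\<^esub> y))"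
      by (rule N.M.finsum_cong')
        (auto simp: \<delta>w hx intro!: linear_over_closed[OF u] P.lsmult_closed hx)
    also have "\<dots> = u (\<Oplus>\<^bsub>P\<^esub>y\<in>?B. h x y \<odot>\<^bsub>P\<^esub> y)"
      by (rule linear_over_finsum[OF P.M.abelian_group_axioms N.M.abelian_group_axioms u, symmetric])
        (auto intro!: P.lsmult_closed hx)
    also have "\<dots> = u x"
      using eh[OF x] by (simp add: free_extension_def)
    finally show "\<delta> (?s x) = u x" .
  qed
qed

section \<open>Group rings\<close>

definition group_ring_single :: "'s ring \<Rightarrow> 'g monoid \<Rightarrow> 'g \<Rightarrow> 's \<Rightarrow> 'g \<Rightarrow> 's"
  where "group_ring_single S G g s = (\<lambda>x\<in>carrier G. if x = g then s else \<zero>\<^bsub>S\<^esub>)"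

lemma group_ring_const_single: "group_ring_const S G s = group_ring_single S G \<one>\<^bsub>G\<^esub> s"
  by (simp add: group_ring_const_def group_ring_single_def)

lemma action_module_smult_single:
  assumes "ring R" "finite (carrier G)" "g \<in> carrier G" "\<zero>\<^bsub>S\<^esub> = \<zero>\<^bsub>R\<^esub>"
    and t: "t \<in> carrier R" and act: "\<And>h. h \<in> carrier G \<Longrightarrow> act h r \<in> carrier R"
  shows "group_ring_single S G g t \<odot>\<^bsub>action_module R G act\<^esub> r = t \<otimes>\<^bsub>R\<^esub> act g r"
proof -
  interpret R: ring R by fact
  have "(\<Oplus>\<^bsub>R\<^esub>h\<in>carrier G. group_ring_single S G g t h \<otimes>\<^bsub>R\<^esub> act h r)
      = (\<Oplus>\<^bsub>R\<^esub>h\<in>carrier G. if g = h then t \<otimes>\<^bsub>R\<^esub> act h r else \<zero>\<^bsub>R\<^esub>)"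
    by (rule R.finsum_cong') (use assms in \<open>auto simp: group_ring_single_def act\<close>)
  also have "\<dots> = t \<otimes>\<^bsub>R\<^esub> act g r"
    by (rule R.finsum_singleton) (use assms in auto)
  finally show ?thesis by (simp add: action_module_def)
qed

locale finite_group_ring = S: cring S + G: group G
  for S :: "'s ring" and G :: "'g monoid" +
  assumes finite_group: "finite (carrier G)"
begin

abbreviation "A \<equiv> group_ring S G"
abbreviation "single \<equiv> group_ring_single S G"
text \<open>
  The copy of \<open>S\<close> inside the group ring; \<open>linear_over scalars\<close> means \<open>S\<close>-linear.
\<close>

abbreviation "scalars \<equiv> group_ring_const S G ` carrier S"

lemma group_ring_value: "a \<in> carrier A \<Longrightarrow> x \<in> carrier G \<Longrightarrow> a x \<in> carrier S"
  by (auto simp: group_ring_def)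

lemma single_closed: "s \<in> carrier S \<Longrightarrow> single g s \<in> carrier A"
  by (auto simp: group_ring_def group_ring_single_def)

lemma const_closed: "s \<in> carrier S \<Longrightarrow> group_ring_const S G s \<in> carrier A"
  by (simp add: group_ring_const_single single_closed)

lemma scalars_subset: "scalars \<subseteq> carrier A"
  using const_closed by auto

lemma single_mult:
  assumes "g \<in> carrier G" "s \<in> carrier S" "a \<in> carrier A"
  shows "single g s \<otimes>\<^bsub>A\<^esub> a = (\<lambda>x\<in>carrier G. s \<otimes>\<^bsub>S\<^esub> a (inv\<^bsub>G\<^esub> g \<otimes>\<^bsub>G\<^esub> x))"
proof -
  have "(\<Oplus>\<^bsub>S\<^esub>y\<in>carrier G. single g s y \<otimes>\<^bsub>S\<^esub> a (inv\<^bsub>G\<^esub> y \<otimes>\<^bsub>G\<^esub> x))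
      = s \<otimes>\<^bsub>S\<^esub> a (inv\<^bsub>G\<^esub> g \<otimes>\<^bsub>G\<^esub> x)" if x: "x \<in> carrier G" for x
  proof -
    have val: "a (inv\<^bsub>G\<^esub> y \<otimes>\<^bsub>G\<^esub> x) \<in> carrier S" if "y \<in> carrier G" for y
      using assms(3) x that by (intro group_ring_value) auto
    have "(\<Oplus>\<^bsub>S\<^esub>y\<in>carrier G. single g s y \<otimes>\<^bsub>S\<^esub> a (inv\<^bsub>G\<^esub> y \<otimes>\<^bsub>G\<^esub> x))
        = (\<Oplus>\<^bsub>S\<^esub>y\<in>carrier G. if g = y then s \<otimes>\<^bsub>S\<^esub> a (inv\<^bsub>G\<^esub> y \<otimes>\<^bsub>G\<^esub> x) else \<zero>\<^bsub>S\<^esub>)"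
      by (rule S.finsum_cong')
        (use assms(1,2) in \<open>auto simp: group_ring_single_def val\<close>)
    also have "\<dots> = s \<otimes>\<^bsub>S\<^esub> a (inv\<^bsub>G\<^esub> g \<otimes>\<^bsub>G\<^esub> x)"
      by (rule S.finsum_singleton)
        (use assms(1,2) finite_group in \<open>auto simp: val\<close>)
    finally show ?thesis .
  qed
  then show ?thesis
    by (simp add: group_ring_def fun_eq_iff)
qed

lemma single_mult_single:
  assumes "g \<in> carrier G" "h \<in> carrier G" "s \<in> carrier S" "t \<in> carrier S"
  shows "single g s \<otimes>\<^bsub>A\<^esub> single h t = single (g \<otimes>\<^bsub>G\<^esub> h) (s \<otimes>\<^bsub>S\<^esub> t)"
proof -
  have "inv\<^bsub>G\<^esub> g \<otimes>\<^bsub>G\<^esub> x = h \<longleftrightarrow> x = g \<otimes>\<^bsub>G\<^esub> h" if "x \<in> carrier G" for x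
    using assms that G.inv_solve_left' by auto
  then show ?thesis
    using assms unfolding single_mult[OF assms(1,3) single_closed[OF assms(4)]]
    by (auto simp: group_ring_single_def fun_eq_iff)
qed

lemma single_mult_const:
  assumes "g \<in> carrier G" "s \<in> carrier S" "t \<in> carrier S"
  shows "group_ring_const S G t \<otimes>\<^bsub>A\<^esub> single g s = single g (t \<otimes>\<^bsub>S\<^esub> s)"
    and "single g s \<otimes>\<^bsub>A\<^esub> group_ring_const S G t = single g (t \<otimes>\<^bsub>S\<^esub> s)"
  using assms by (simp_all add: group_ring_const_single single_mult_single S.m_comm)

lemma const_mult:
  assumes "s \<in> carrier S" "a \<in> carrier A"
  shows "group_ring_const S G s \<otimes>\<^bsub>A\<^esub> a = (\<lambda>x\<in>carrier G. s \<otimes>\<^bsub>S\<^esub> a x)"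
  using assms by (auto simp: group_ring_const_single single_mult fun_eq_iff)

lemma const_add:
  assumes "s \<in> carrier S" "t \<in> carrier S"
  shows "group_ring_const S G (s \<oplus>\<^bsub>S\<^esub> t) = group_ring_const S G s \<oplus>\<^bsub>A\<^esub> group_ring_const S G t"
  using assms by (auto simp: group_ring_const_def group_ring_def fun_eq_iff)

lemma const_mult_const:
  assumes "s \<in> carrier S" "t \<in> carrier S"
  shows "group_ring_const S G (s \<otimes>\<^bsub>S\<^esub> t) = group_ring_const S G s \<otimes>\<^bsub>A\<^esub> group_ring_const S G t"
  using assms by (simp add: group_ring_const_single single_mult_single)

text \<open>
  The group elements form an \<open>S\<close>-basis of the group ring.
\<close>

lemma group_ring_eq_finsum_single:
  assumes A: "abelian_group A" and a: "a \<in> carrier A"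
  shows "a = (\<Oplus>\<^bsub>A\<^esub>g\<in>carrier G. single g (a g))"
proof
  interpret A: abelian_group A by fact
  fix x
  have cl: "single g (a g) \<in> carrier A" if "g \<in> carrier G" for g
    using that by (intro single_closed group_ring_value[OF a])
  have sum_cl: "(\<Oplus>\<^bsub>A\<^esub>g\<in>carrier G. single g (a g)) \<in> carrier A"
    by (rule A.finsum_closed) (auto intro: cl)
  show "a x = (\<Oplus>\<^bsub>A\<^esub>g\<in>carrier G. single g (a g)) x"
  proof (cases "x \<in> carrier G")
    case True
    have "(\<Oplus>\<^bsub>A\<^esub>g\<in>B. single g (a g)) x = (\<Oplus>\<^bsub>S\<^esub>g\<in>B. single g (a g) x)"
      if "finite B" "B \<subseteq> carrier G" for B
      using that
    proof (induction B)
      case empty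
      have "\<zero>\<^bsub>A\<^esub> x = \<zero>\<^bsub>S\<^esub>" using True by (simp add: group_ring_def)
      then show ?case by simp
    next
      case (insert g B)
      have "(\<Oplus>\<^bsub>A\<^esub>g\<in>insert g B. single g (a g)) x
          = (single g (a g) \<oplus>\<^bsub>A\<^esub> (\<Oplus>\<^bsub>A\<^esub>g\<in>B. single g (a g))) x"
        using insert cl by (subst A.finsum_insert) auto
      also have "\<dots> = single g (a g) x \<oplus>\<^bsub>S\<^esub> (\<Oplus>\<^bsub>S\<^esub>g\<in>B. single g (a g) x)"
        using insert True by (simp add: group_ring_def)
      also have "\<dots> = (\<Oplus>\<^bsub>S\<^esub>g\<in>insert g B. single g (a g) x)"
        using insert True by (subst S.finsum_insert) (auto intro!: group_ring_value cl)
      finally show ?case .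
    qed
    from this[OF finite_group]
    have "(\<Oplus>\<^bsub>A\<^esub>g\<in>carrier G. single g (a g)) x = (\<Oplus>\<^bsub>S\<^esub>g\<in>carrier G. single g (a g) x)"
      by simp
    moreover have "(\<Oplus>\<^bsub>S\<^esub>g\<in>carrier G. single g (a g) x) = (\<Oplus>\<^bsub>S\<^esub>g\<in>carrier G. if x = g then a g else \<zero>\<^bsub>S\<^esub>)"
      by (rule S.finsum_cong') (use True a in \<open>auto simp: group_ring_single_def group_ring_value\<close>)
    moreover have "\<dots> = a x"
      by (rule S.finsum_singleton) (use True a finite_group in \<open>auto simp: group_ring_value\<close>)
    ultimately show ?thesis by simp
  next
    case False
    then show ?thesis using a sum_cl by (auto simp: group_ring_def PiE_iff extensional_def)
  qed
qed

end

section \<open>Splitting a resolution over the scalars\<close>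

context finite_group_ring
begin

text \<open>
  The group ring is free over \<open>S\<close> on the group elements, so it suffices to lift the values there.
\<close>

lemma lift_from_group_ring:
  assumes M: "left_module A M" and N: "left_module A N" and \<delta>: "\<delta> \<in> mod_hom A M N"
    and c: "linear_over scalars (regular_module A) N c"
    and im: "\<And>a. a \<in> carrier A \<Longrightarrow> c a \<in> \<delta> ` carrier M"
  shows "\<exists>w. linear_over scalars (regular_module A) M w \<and> (\<forall>a\<in>carrier A. \<delta> (w a) = c a)"
proof -
  interpret M: left_module A M by fact
  interpret N: left_module A N by fact
  let ?\<kappa> = "group_ring_const S G"
  have \<delta>': "linear_over (carrier A) M N \<delta>"
    by (rule mod_hom_linear_over[OF \<delta>]) simp
  have one: "single g \<one>\<^bsub>S\<^esub> \<in> carrier A" for g by (simp add: single_closed)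
  have "\<exists>y. y \<in> carrier M \<and> \<delta> y = c (single g \<one>\<^bsub>S\<^esub>)" for g
    using im[OF one[of g]] by auto
  then have "\<exists>m. \<forall>g. m g \<in> carrier M \<and> \<delta> (m g) = c (single g \<one>\<^bsub>S\<^esub>)"
    by (intro choice allI)
  then obtain m where m: "\<And>g. m g \<in> carrier M" "\<And>g. \<delta> (m g) = c (single g \<one>\<^bsub>S\<^esub>)"
    by blast
  let ?w = "\<lambda>a. \<Oplus>\<^bsub>M\<^esub>g\<in>carrier G. ?\<kappa> (a g) \<odot>\<^bsub>M\<^esub> m g"
  have term_cl: "?\<kappa> s \<odot>\<^bsub>M\<^esub> m g \<in> carrier M" if "s \<in> carrier S" for s g
    using that m by (intro M.lsmult_closed const_closed)
  have "linear_over scalars (regular_module A) M ?w"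
  proof (rule linear_overI)
    fix a assume "a \<in> carrier (regular_module A)"
    then show "?w a \<in> carrier M"
      by (intro M.M.finsum_closed) (auto simp: regular_module_def intro!: term_cl group_ring_value)
  next
    fix a b assume ab: "a \<in> carrier (regular_module A)" "b \<in> carrier (regular_module A)"
    then have v: "a g \<in> carrier S" "b g \<in> carrier S" if "g \<in> carrier G" for g
      using that by (auto simp: regular_module_def group_ring_value)
    have "?w (a \<oplus>\<^bsub>regular_module A\<^esub> b)
        = (\<Oplus>\<^bsub>M\<^esub>g\<in>carrier G. ?\<kappa> (a g) \<odot>\<^bsub>M\<^esub> m g \<oplus>\<^bsub>M\<^esub> ?\<kappa> (b g) \<odot>\<^bsub>M\<^esub> m g)"
    proof (rule M.M.finsum_cong'[OF refl])
      fix g assume g: "g \<in> carrier G"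
      have "(a \<oplus>\<^bsub>regular_module A\<^esub> b) g = a g \<oplus>\<^bsub>S\<^esub> b g"
        using g by (simp add: regular_module_def group_ring_def)
      then show "?\<kappa> ((a \<oplus>\<^bsub>regular_module A\<^esub> b) g) \<odot>\<^bsub>M\<^esub> m g
          = ?\<kappa> (a g) \<odot>\<^bsub>M\<^esub> m g \<oplus>\<^bsub>M\<^esub> ?\<kappa> (b g) \<odot>\<^bsub>M\<^esub> m g"
        using v[OF g] m const_closed by (simp add: const_add M.lsmult_l_distr)
    qed (auto intro!: term_cl v)
    also have "\<dots> = ?w a \<oplus>\<^bsub>M\<^esub> ?w b"
      by (rule M.M.finsum_addf) (auto intro!: term_cl v)
    finally show "?w (a \<oplus>\<^bsub>regular_module A\<^esub> b) = ?w a \<oplus>\<^bsub>M\<^esub> ?w b" .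
  next
    fix t a assume "t \<in> scalars" and a: "a \<in> carrier (regular_module A)"
    then obtain s where s: "s \<in> carrier S" "t = ?\<kappa> s" by auto
    have t: "t \<in> carrier A" using s const_closed by simp
    have v: "a g \<in> carrier S" if "g \<in> carrier G" for g
      using a that by (auto simp: regular_module_def group_ring_value)
    have lin: "linear_over {} M M (\<lambda>y. t \<odot>\<^bsub>M\<^esub> y)"
      by (rule linear_overI) (use t M.lsmult_closed M.lsmult_r_distr in auto)
    have "?w (t \<odot>\<^bsub>regular_module A\<^esub> a) = (\<Oplus>\<^bsub>M\<^esub>g\<in>carrier G. t \<odot>\<^bsub>M\<^esub> (?\<kappa> (a g) \<odot>\<^bsub>M\<^esub> m g))"
    proof (rule M.M.finsum_cong'[OF refl])
      fix g assume g: "g \<in> carrier G"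
      have "(t \<odot>\<^bsub>regular_module A\<^esub> a) g = s \<otimes>\<^bsub>S\<^esub> a g"
        using g a s by (simp add: regular_module_def const_mult)
      then show "?\<kappa> ((t \<odot>\<^bsub>regular_module A\<^esub> a) g) \<odot>\<^bsub>M\<^esub> m g = t \<odot>\<^bsub>M\<^esub> (?\<kappa> (a g) \<odot>\<^bsub>M\<^esub> m g)"
        using v[OF g] m s const_closed by (simp add: const_mult_const M.lsmult_assoc)
    qed (auto intro!: term_cl v M.lsmult_closed t)
    also have "\<dots> = t \<odot>\<^bsub>M\<^esub> ?w a"
      by (rule linear_over_finsum[OF M.M.abelian_group_axioms M.M.abelian_group_axioms lin, symmetric])
        (auto intro!: term_cl v)
    finally show "?w (t \<odot>\<^bsub>regular_module A\<^esub> a) = t \<odot>\<^bsub>M\<^esub> ?w a" .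
  qed
  moreover have "\<delta> (?w a) = c a" if a: "a \<in> carrier A" for a
  proof -
    have v: "a g \<in> carrier S" if "g \<in> carrier G" for g
      using a that by (auto simp: group_ring_value)
    have "\<delta> (?w a) = (\<Oplus>\<^bsub>N\<^esub>g\<in>carrier G. \<delta> (?\<kappa> (a g) \<odot>\<^bsub>M\<^esub> m g))"
      by (rule linear_over_finsum[OF M.M.abelian_group_axioms N.M.abelian_group_axioms \<delta>'])
        (auto intro!: term_cl v)
    also have "\<dots> = (\<Oplus>\<^bsub>N\<^esub>g\<in>carrier G. c (single g (a g)))"
    proof (rule N.M.finsum_cong'[OF refl])
      fix g assume g: "g \<in> carrier G"
      have "\<delta> (?\<kappa> (a g) \<odot>\<^bsub>M\<^esub> m g) = ?\<kappa> (a g) \<odot>\<^bsub>N\<^esub> c (single g \<one>\<^bsub>S\<^esub>)"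
        using linear_over_smult[OF \<delta>'] m v[OF g] const_closed by simp
      also have "\<dots> = c (?\<kappa> (a g) \<otimes>\<^bsub>A\<^esub> single g \<one>\<^bsub>S\<^esub>)"
        using linear_over_smult[OF c, of "?\<kappa> (a g)" "single g \<one>\<^bsub>S\<^esub>"] v[OF g] one
        by (simp add: regular_module_def)
      also have "\<dots> = c (single g (a g))"
        using g v by (simp add: single_mult_const)
      finally show "\<delta> (?\<kappa> (a g) \<odot>\<^bsub>M\<^esub> m g) = c (single g (a g))" .
    qed (use linear_over_closed[OF c] v single_closed in \<open>auto simp: regular_module_def\<close>)
    also have "\<dots> = c (finsum (regular_module A) (\<lambda>g. single g (a g)) (carrier G))"
      using left_module_regular[OF M.A.ring_axioms] v single_closed
      by (intro linear_over_finsum[OF _ N.M.abelian_group_axioms c, symmetric])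
        (auto simp: left_module_def regular_module_def)
    also have "finsum (regular_module A) (\<lambda>g. single g (a g)) (carrier G)
        = (\<Oplus>\<^bsub>A\<^esub>g\<in>carrier G. single g (a g))"
      by (rule finsum_regular_module)
    also have "\<dots> = a"
      using group_ring_eq_finsum_single[OF M.A.abelian_group_axioms a] by simp
    finally show ?thesis .
  qed
  ultimately show ?thesis by blast
qed

text \<open>
  A projective \<open>S[G]\<close>-module is projective over \<open>S\<close>.
\<close>

lemma projective_lift_over_scalars:
  assumes P: "projective_module A P" and M: "left_module A M" and N: "left_module A N"
    and \<delta>: "\<delta> \<in> mod_hom A M N"
    and u: "linear_over scalars P N u" and im: "\<And>x. x \<in> carrier P \<Longrightarrow> u x \<in> \<delta> ` carrier M"
  obtains s where "linear_over scalars P M s" "\<And>x. x \<in> carrier P \<Longrightarrow> \<delta> (s x) = u x"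
proof (rule projective_module_lift[OF P scalars_subset M N])
  have "left_module A P" using P by (simp add: projective_module_def)
  then interpret P: left_module A P .
  show "linear_over {} M N \<delta>" by (rule mod_hom_linear_over[OF \<delta>]) simp
  show "linear_over {} P N u" using u by (auto simp: linear_over_def)
  fix y assume y: "y \<in> carrier P"
  have "linear_over scalars (regular_module A) P (\<lambda>a. a \<odot>\<^bsub>P\<^esub> y)"
    by (rule linear_overI)
      (use y scalars_subset P.lsmult_closed P.lsmult_l_distr P.lsmult_assoc
        in \<open>auto simp: regular_module_def\<close>)
  from linear_over_compose[OF this u]
  have "linear_over scalars (regular_module A) N (\<lambda>a. u (a \<odot>\<^bsub>P\<^esub> y))" .
  then show "\<exists>w. linear_over scalars (regular_module A) M w \<and> (\<forall>a\<in>carrier A. \<delta> (w a) = u (a \<odot>\<^bsub>P\<^esub> y))"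
    by (rule lift_from_group_ring[OF M N \<delta>]) (rule im[OF P.lsmult_closed[OF _ y]])
qed (rule that)

lemma const_smult_trivial:
  assumes "s \<in> carrier S" "b \<in> carrier S"
  shows "group_ring_const S G s \<odot>\<^bsub>trivial_module S G\<^esub> b = s \<otimes>\<^bsub>S\<^esub> b"
  unfolding trivial_module_def group_ring_const_single
  by (rule action_module_smult_single) (use assms finite_group S.ring_axioms in auto)

text \<open>
  The trivial module is free over \<open>S\<close> of rank one, so \<open>\<epsilon>\<close> splits over \<open>S\<close>.
\<close>

lemma augmentation_section:
  assumes P: "left_module A P" and \<epsilon>: "\<epsilon> \<in> mod_hom A P (trivial_module S G)"
    and surj: "\<epsilon> ` carrier P = carrier (trivial_module S G)"
  obtains s where "linear_over scalars (trivial_module S G) P s" "\<And>b. b \<in> carrier S \<Longrightarrow> \<epsilon> (s b) = b"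
proof -
  interpret P: left_module A P by fact
  have "\<one>\<^bsub>S\<^esub> \<in> \<epsilon> ` carrier P"
    using surj by (simp add: trivial_module_def action_module_def)
  then obtain e where e: "e \<in> carrier P" "\<epsilon> e = \<one>\<^bsub>S\<^esub>" by auto
  show thesis
  proof (rule that)
    show "linear_over scalars (trivial_module S G) P (\<lambda>b. group_ring_const S G b \<odot>\<^bsub>P\<^esub> e)"
    proof (rule linear_overI)
      fix t b assume "t \<in> scalars" and b: "b \<in> carrier (trivial_module S G)"
      then obtain s where s: "s \<in> carrier S" "t = group_ring_const S G s" by auto
      have "b \<in> carrier S" using b by (simp add: trivial_module_def action_module_def)
      then show "group_ring_const S G (t \<odot>\<^bsub>trivial_module S G\<^esub> b) \<odot>\<^bsub>P\<^esub> e
          = t \<odot>\<^bsub>P\<^esub> (group_ring_const S G b \<odot>\<^bsub>P\<^esub> e)"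
        using s e const_closed by (simp add: const_smult_trivial const_mult_const P.lsmult_assoc)
    qed (use e const_closed P.lsmult_closed P.lsmult_l_distr
        in \<open>auto simp: trivial_module_def action_module_def const_add\<close>)
    fix b assume b: "b \<in> carrier S"
    have "\<epsilon> (group_ring_const S G b \<odot>\<^bsub>P\<^esub> e) = group_ring_const S G b \<odot>\<^bsub>trivial_module S G\<^esub> \<epsilon> e"
      using \<epsilon> e const_closed[OF b] by (auto simp: mod_hom_def)
    then show "\<epsilon> (group_ring_const S G b \<odot>\<^bsub>P\<^esub> e) = b"
      using b e by (simp add: const_smult_trivial)
  qed
qed

text \<open>
  The usual construction of a contracting homotopy: if \<open>d s d = d\<close> for the differential \<open>d\<close> that
  leaves \<open>P n\<close>, then \<open>1 - s d\<close> maps into the kernel of \<open>d\<close>, which is the image of \<open>\<delta> n\<close>. A lift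
  \<open>s'\<close> of it along \<open>\<delta> n\<close> satisfies \<open>\<delta> s' \<delta> = \<delta> - s d \<delta> = \<delta>\<close>. The induction starts with
  \<open>d = \<epsilon>\<close>.
\<close>

lemma resolution_splits_over_scalars:
  fixes P :: "nat \<Rightarrow> ('g \<Rightarrow> 's, 'p) module"
  assumes res: "projective_resolution A P \<delta> \<epsilon> (trivial_module S G)"
  shows "\<exists>s. linear_over scalars (P n) (P (Suc n)) s \<and>
    (\<forall>x\<in>carrier (P (Suc n)). \<delta> n (s (\<delta> n x)) = \<delta> n x)"
proof -
  let ?T = "trivial_module S G"
  have proj: "projective_module A (P n)"
    and \<delta>: "\<delta> n \<in> mod_hom A (P (Suc n)) (P n)"
    and exact: "\<delta> (Suc n) ` carrier (P (Suc (Suc n))) = {x \<in> carrier (P (Suc n)). \<delta> n x = \<zero>\<^bsub>P n\<^esub>}" for n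
    using res by (auto simp: projective_resolution_def)
  have T: "left_module A ?T" and \<epsilon>: "\<epsilon> \<in> mod_hom A (P 0) ?T"
    and surj: "\<epsilon> ` carrier (P 0) = carrier ?T"
    and exact0: "\<delta> 0 ` carrier (P (Suc 0)) = {x \<in> carrier (P 0). \<epsilon> x = \<zero>\<^bsub>?T\<^esub>}"
    using res by (auto simp: projective_resolution_def)
  have lm: "left_module A (P n)" for n
    using proj by (simp add: projective_module_def)
  have ab: "abelian_group (P n)" for n using lm[of n] by (simp add: left_module_def)
  have \<delta>_lin: "linear_over scalars (P (Suc n)) (P n) (\<delta> n)" for n
    by (rule mod_hom_linear_over[OF \<delta> scalars_subset])
  have id: "linear_over scalars (P n) (P n) (\<lambda>x. x)" for n
    by (rule linear_overI) auto
  have split: "\<exists>s'. linear_over scalars (P n) (P (Suc n)) s' \<and>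
      (\<forall>x\<in>carrier (P (Suc n)). \<delta> n (s' (\<delta> n x)) = \<delta> n x)"
    if N: "abelian_group N"
      and d: "linear_over scalars (P n) N d" and s: "linear_over scalars N (P n) s"
      and ds: "\<And>x. x \<in> carrier (P n) \<Longrightarrow> d (s (d x)) = d x"
      and ex: "\<delta> n ` carrier (P (Suc n)) = {x \<in> carrier (P n). d x = \<zero>\<^bsub>N\<^esub>}"
    for n and N :: "('g \<Rightarrow> 's, 'n) module" and d s
  proof -
    interpret Pn: abelian_group "P n" by (rule ab)
    interpret N: abelian_group N by (rule N)
    let ?u = "\<lambda>x. x \<ominus>\<^bsub>P n\<^esub> s (d x)"
    note dcl = linear_over_closed[OF d] and scl = linear_over_closed[OF s]
    have u: "linear_over scalars (P n) (P n) ?u"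
      by (rule linear_over_diff[OF lm scalars_subset id linear_over_compose[OF d s]])
    have "?u x \<in> \<delta> n ` carrier (P (Suc n))" if x: "x \<in> carrier (P n)" for x
    proof -
      have "d (?u x) = d x \<oplus>\<^bsub>N\<^esub> \<ominus>\<^bsub>N\<^esub> d (s (d x))"
        using x linear_over_add[OF d] linear_over_minus[OF ab N d] dcl scl
        by (simp add: a_minus_def)
      also have "\<dots> = \<zero>\<^bsub>N\<^esub>" using x ds dcl by (simp add: N.r_neg)
      finally show ?thesis
        unfolding ex using linear_over_closed[OF u] x by simp
    qed
    then obtain s' where s': "linear_over scalars (P n) (P (Suc n)) s'"
        "\<And>x. x \<in> carrier (P n) \<Longrightarrow> \<delta> n (s' x) = ?u x"
      using projective_lift_over_scalars[OF proj lm lm \<delta> u] by blast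
    have "\<delta> n (s' (\<delta> n x)) = \<delta> n x" if x: "x \<in> carrier (P (Suc n))" for x
    proof -
      have \<delta>x: "\<delta> n x \<in> carrier (P n)" and d0: "d (\<delta> n x) = \<zero>\<^bsub>N\<^esub>" using ex x by auto
      have "s \<zero>\<^bsub>N\<^esub> = \<zero>\<^bsub>P n\<^esub>" by (rule linear_over_zero[OF N ab s])
      then show ?thesis using s'(2)[OF \<delta>x] d0 \<delta>x by (simp add: a_minus_def)
    qed
    with s'(1) show ?thesis by blast
  qed
  show ?thesis
  proof (induction n)
    case 0
    obtain s where s: "linear_over scalars ?T (P 0) s" "\<And>b. b \<in> carrier S \<Longrightarrow> \<epsilon> (s b) = b"
      using augmentation_section[OF lm \<epsilon> surj] by blast
    have "\<epsilon> (s (\<epsilon> x)) = \<epsilon> x" if "x \<in> carrier (P 0)" for x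
    proof -
      have "\<epsilon> x \<in> carrier ?T" using surj that by blast
      then show ?thesis by (intro s(2)) (simp add: trivial_module_def action_module_def)
    qed
    moreover have "abelian_group ?T" using T by (simp add: left_module_def)
    ultimately show ?case
      using mod_hom_linear_over[OF \<epsilon> scalars_subset] s(1) exact0 by (intro split) auto
  next
    case (Suc n)
    then obtain s where "linear_over scalars (P n) (P (Suc n)) s"
      "\<And>x. x \<in> carrier (P (Suc n)) \<Longrightarrow> \<delta> n (s (\<delta> n x)) = \<delta> n x" by blast
    then show ?case
      using exact by (intro split[OF ab \<delta>_lin])
  qed
qed

end

section \<open>Transfers annihilate cohomology\<close>

locale ring_action = R: cring R + G: group G
  for R :: "'r ring" and G :: "'g monoid" +
  fixes act :: "'g \<Rightarrow> 'r \<Rightarrow> 'r"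
  assumes finite_acting_group: "finite (carrier G)"
    and act_hom: "g \<in> carrier G \<Longrightarrow> act g \<in> ring_hom R R"
    and act_mult: "\<lbrakk>g \<in> carrier G; h \<in> carrier G; r \<in> carrier R\<rbrakk>
      \<Longrightarrow> act (g \<otimes>\<^bsub>G\<^esub> h) r = act g (act h r)"
    and act_one: "r \<in> carrier R \<Longrightarrow> act \<one>\<^bsub>G\<^esub> r = r"
begin

abbreviation "S \<equiv> invariant_ring R G act"
abbreviation "N \<equiv> action_module R G act"

lemma act_closed: "g \<in> carrier G \<Longrightarrow> r \<in> carrier R \<Longrightarrow> act g r \<in> carrier R"
  using act_hom ring_hom_closed by fastforce

lemma act_ring_hom_cring: "g \<in> carrier G \<Longrightarrow> ring_hom_cring R R (act g)"
  by (intro ring_hom_cring.intro ring_hom_cring_axioms.intro act_hom R.cring_axioms)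

lemma invariant_ring_simps [simp]:
  "carrier S = {r \<in> carrier R. \<forall>g\<in>carrier G. act g r = r}"
  "monoid.mult S = monoid.mult R" "one S = one R" "ring.zero S = ring.zero R" "add S = add R"
  by (simp_all add: invariant_ring_def)

lemma cring_invariant_ring: "cring S"
proof -
  have "subring {r \<in> carrier R. \<forall>g\<in>carrier G. act g r = r} R"
  proof (rule R.subringI)
    fix r assume r: "r \<in> {r \<in> carrier R. \<forall>g\<in>carrier G. act g r = r}"
    have "act g (\<ominus>\<^bsub>R\<^esub> r) = \<ominus>\<^bsub>R\<^esub> r" if "g \<in> carrier G" for g
    proof -
      interpret g: ring_hom_cring R R "act g" by (rule act_ring_hom_cring[OF that])
      show ?thesis using r that by simp
    qed
    then show "\<ominus>\<^bsub>R\<^esub> r \<in> {r \<in> carrier R. \<forall>g\<in>carrier G. act g r = r}" using r by auto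
  next
    show "\<one>\<^bsub>R\<^esub> \<in> {r \<in> carrier R. \<forall>g\<in>carrier G. act g r = r}"
      using act_hom ring_hom_one by fastforce
  qed (auto simp: ring_hom_mult[OF act_hom] ring_hom_add[OF act_hom])
  then have "subcring {r \<in> carrier R. \<forall>g\<in>carrier G. act g r = r} R"
    by (rule R.subcringI')
  then show ?thesis
    unfolding invariant_ring_def using R.subcring_iff subcringE(1) by blast
qed

sublocale finite_group_ring S G
  by (intro finite_group_ring.intro finite_group_ring_axioms.intro cring_invariant_ring
      G.group_axioms finite_acting_group)

definition transfer :: "'r \<Rightarrow> 'r"
  where "transfer r = (\<Oplus>\<^bsub>R\<^esub>g\<in>carrier G. act g r)"

lemma finsum_translate:
  assumes k: "k \<in> carrier G" and f: "f \<in> carrier G \<rightarrow> carrier R"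
  shows "(\<Oplus>\<^bsub>R\<^esub>g\<in>carrier G. f (k \<otimes>\<^bsub>G\<^esub> g)) = (\<Oplus>\<^bsub>R\<^esub>g\<in>carrier G. f g)"
proof -
  have im: "(\<lambda>g. k \<otimes>\<^bsub>G\<^esub> g) ` carrier G = carrier G"
  proof (intro equalityI subsetI)
    fix g assume "g \<in> carrier G"
    then show "g \<in> (\<lambda>g. k \<otimes>\<^bsub>G\<^esub> g) ` carrier G"
      using k by (intro image_eqI[of _ _ "inv\<^bsub>G\<^esub> k \<otimes>\<^bsub>G\<^esub> g"]) (auto simp: G.m_assoc[symmetric])
  qed (use k in auto)
  have inj: "inj_on (\<lambda>g. k \<otimes>\<^bsub>G\<^esub> g) (carrier G)"
    using k by (auto intro!: inj_onI)
  show ?thesis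
    using R.finsum_reindex[OF _ inj, of f] f by (simp add: im)
qed

lemma transfer_closed:
  assumes r: "r \<in> carrier R"
  shows "transfer r \<in> carrier S"
proof -
  have cl: "(\<lambda>g. act g r) \<in> carrier G \<rightarrow> carrier R" using r by (auto intro: act_closed)
  have "act k (transfer r) = transfer r" if k: "k \<in> carrier G" for k
  proof -
    interpret k: ring_hom_cring R R "act k" by (rule act_ring_hom_cring[OF k])
    have "act k (transfer r) = (\<Oplus>\<^bsub>R\<^esub>g\<in>carrier G. act k (act g r))"
      unfolding transfer_def using k.hom_finsum[OF cl] by (simp add: comp_def)
    also have "\<dots> = (\<Oplus>\<^bsub>R\<^esub>g\<in>carrier G. act (k \<otimes>\<^bsub>G\<^esub> g) r)"
      by (rule R.finsum_cong') (use k r in \<open>auto simp: act_mult intro!: act_closed\<close>)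
    also have "\<dots> = transfer r"
      unfolding transfer_def by (rule finsum_translate[OF k cl])
    finally show ?thesis .
  qed
  then show ?thesis
    using cl by (auto simp: transfer_def intro: R.finsum_closed)
qed

lemma action_module_simps [simp]:
  "carrier N = carrier R" "ring.zero N = ring.zero R" "add N = add R"
  "a \<odot>\<^bsub>N\<^esub> r = (\<Oplus>\<^bsub>R\<^esub>g\<in>carrier G. a g \<otimes>\<^bsub>R\<^esub> act g r)"
  by (simp_all add: action_module_def)

lemma finsum_action_module: "finsum N = (finsum R :: ('i \<Rightarrow> _) \<Rightarrow> _)"
  by (simp add: fun_eq_iff finsum_def finprod_def)

lemma abelian_group_action_module: "abelian_group N"
proof (rule abelian_groupI)
  fix x assume "x \<in> carrier N"
  then show "\<exists>y\<in>carrier N. y \<oplus>\<^bsub>N\<^esub> x = \<zero>\<^bsub>N\<^esub>"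
    by (intro bexI[of _ "\<ominus>\<^bsub>R\<^esub> x"]) (auto simp: R.l_neg)
qed (auto simp: R.a_ac)

lemma a_inv_action_module: "x \<in> carrier R \<Longrightarrow> \<ominus>\<^bsub>N\<^esub> x = \<ominus>\<^bsub>R\<^esub> x"
  using abelian_group.minus_equality[OF abelian_group_action_module, of "\<ominus>\<^bsub>R\<^esub> x" x]
  by (simp add: R.l_neg)

lemma group_ring_value_R: "a \<in> carrier A \<Longrightarrow> g \<in> carrier G \<Longrightarrow> a g \<in> carrier R"
  using group_ring_value by auto

lemma smult_action_closed:
  assumes "a \<in> carrier A" "r \<in> carrier R"
  shows "a \<odot>\<^bsub>N\<^esub> r \<in> carrier R"
  using assms group_ring_value_R[OF assms(1)] act_closed by (auto intro!: R.finsum_closed)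

lemma smult_action_add:
  assumes a: "a \<in> carrier A" and r: "r \<in> carrier R" "r' \<in> carrier R"
  shows "a \<odot>\<^bsub>N\<^esub> (r \<oplus>\<^bsub>R\<^esub> r') = a \<odot>\<^bsub>N\<^esub> r \<oplus>\<^bsub>R\<^esub> a \<odot>\<^bsub>N\<^esub> r'"
proof -
  note cl = group_ring_value_R[OF a] act_closed
  have "(\<Oplus>\<^bsub>R\<^esub>g\<in>carrier G. a g \<otimes>\<^bsub>R\<^esub> act g (r \<oplus>\<^bsub>R\<^esub> r'))
      = (\<Oplus>\<^bsub>R\<^esub>g\<in>carrier G. a g \<otimes>\<^bsub>R\<^esub> act g r \<oplus>\<^bsub>R\<^esub> a g \<otimes>\<^bsub>R\<^esub> act g r')"
    by (rule R.finsum_cong')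
      (use r cl in \<open>auto simp: ring_hom_add[OF act_hom] R.r_distr\<close>)
  also have "\<dots> = (\<Oplus>\<^bsub>R\<^esub>g\<in>carrier G. a g \<otimes>\<^bsub>R\<^esub> act g r)
      \<oplus>\<^bsub>R\<^esub> (\<Oplus>\<^bsub>R\<^esub>g\<in>carrier G. a g \<otimes>\<^bsub>R\<^esub> act g r')"
    by (rule R.finsum_addf) (use r cl in auto)
  finally show ?thesis by simp
qed

lemma single_smult_action:
  assumes "g \<in> carrier G" "t \<in> carrier S" "r \<in> carrier R"
  shows "single g t \<odot>\<^bsub>N\<^esub> r = t \<otimes>\<^bsub>R\<^esub> act g r"
  by (rule action_module_smult_single)
    (use assms finite_acting_group R.ring_axioms in \<open>auto intro: act_closed\<close>)

lemma const_smult_action: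
  assumes "t \<in> carrier S" "r \<in> carrier R"
  shows "group_ring_const S G t \<odot>\<^bsub>N\<^esub> r = t \<otimes>\<^bsub>R\<^esub> r"
  using single_smult_action[of "\<one>\<^bsub>G\<^esub>" t r] assms
  by (simp add: group_ring_const_single act_one del: action_module_simps(4))

text \<open>
  The group ring is generated by the scalars and the group elements, so it suffices to check
  compatibility with these.
\<close>

lemma mod_hom_actionI:
  assumes P: "left_module A P"
    and cl: "\<And>x. x \<in> carrier P \<Longrightarrow> h x \<in> carrier R"
    and add: "\<And>x y. x \<in> carrier P \<Longrightarrow> y \<in> carrier P \<Longrightarrow> h (x \<oplus>\<^bsub>P\<^esub> y) = h x \<oplus>\<^bsub>R\<^esub> h y"
    and const: "\<And>t x. t \<in> carrier S \<Longrightarrow> x \<in> carrier P \<Longrightarrow>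
      h (group_ring_const S G t \<odot>\<^bsub>P\<^esub> x) = t \<otimes>\<^bsub>R\<^esub> h x"
    and grp: "\<And>g x. g \<in> carrier G \<Longrightarrow> x \<in> carrier P \<Longrightarrow> h (single g \<one>\<^bsub>R\<^esub> \<odot>\<^bsub>P\<^esub> x) = act g (h x)"
  shows "restrict h (carrier P) \<in> mod_hom A P N"
proof -
  interpret P: left_module A P by fact
  have h: "linear_over {} P N h"
    by (rule linear_overI) (use cl add in auto)
  have one: "\<one>\<^bsub>R\<^esub> \<in> carrier S" using S.one_closed by simp
  have "h (a \<odot>\<^bsub>P\<^esub> x) = a \<odot>\<^bsub>N\<^esub> h x" if a: "a \<in> carrier A" and x: "x \<in> carrier P" for a x
  proof -
    have sc: "single g (a g) \<in> carrier A" if "g \<in> carrier G" for g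
      by (rule single_closed[OF group_ring_value[OF a that]])
    have lin: "linear_over {} (regular_module A) P (\<lambda>a. a \<odot>\<^bsub>P\<^esub> x)"
      by (rule linear_overI) (use x P.lsmult_closed P.lsmult_l_distr in \<open>auto simp: regular_module_def\<close>)
    have "a = finsum (regular_module A) (\<lambda>g. single g (a g)) (carrier G)"
      using group_ring_eq_finsum_single[OF P.A.abelian_group_axioms a]
      by (simp add: finsum_regular_module)
    then have "a \<odot>\<^bsub>P\<^esub> x = finsum (regular_module A) (\<lambda>g. single g (a g)) (carrier G) \<odot>\<^bsub>P\<^esub> x"
      by (rule arg_cong)
    also have "\<dots> = (\<Oplus>\<^bsub>P\<^esub>g\<in>carrier G. single g (a g) \<odot>\<^bsub>P\<^esub> x)"
      using left_module_regular[OF P.A.ring_axioms]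
      by (intro linear_over_finsum[OF _ P.M.abelian_group_axioms lin])
        (auto simp: left_module_def regular_module_def sc)
    finally have "h (a \<odot>\<^bsub>P\<^esub> x) = h (\<Oplus>\<^bsub>P\<^esub>g\<in>carrier G. single g (a g) \<odot>\<^bsub>P\<^esub> x)"
      by (rule arg_cong)
    also have "\<dots> = (\<Oplus>\<^bsub>R\<^esub>g\<in>carrier G. h (single g (a g) \<odot>\<^bsub>P\<^esub> x))"
      unfolding finsum_action_module[symmetric]
      by (rule linear_over_finsum[OF P.M.abelian_group_axioms abelian_group_action_module h])
        (rule P.lsmult_closed[OF sc x])
    also have "\<dots> = (\<Oplus>\<^bsub>R\<^esub>g\<in>carrier G. a g \<otimes>\<^bsub>R\<^esub> act g (h x))"
    proof (rule R.finsum_cong'[OF refl])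
      fix g assume g: "g \<in> carrier G"
      have ag: "a g \<in> carrier S" by (rule group_ring_value[OF a g])
      have "single g (a g) = group_ring_const S G (a g) \<otimes>\<^bsub>A\<^esub> single g \<one>\<^bsub>R\<^esub>"
        using single_mult_const(1)[OF g one ag] ag by (simp add: R.r_one)
      then have "single g (a g) \<odot>\<^bsub>P\<^esub> x = group_ring_const S G (a g) \<odot>\<^bsub>P\<^esub> (single g \<one>\<^bsub>R\<^esub> \<odot>\<^bsub>P\<^esub> x)"
        using P.lsmult_assoc[OF const_closed[OF ag] single_closed[OF one] x] by simp
      then show "h (single g (a g) \<odot>\<^bsub>P\<^esub> x) = a g \<otimes>\<^bsub>R\<^esub> act g (h x)"
        using const[OF ag P.lsmult_closed[OF single_closed[OF one] x]] grp[OF g x] by simp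
    qed (use group_ring_value_R[OF a] act_closed cl x in auto)
    finally show ?thesis by simp
  qed
  then show ?thesis
    using cl add P.lsmult_closed by (simp add: mod_hom_def)
qed

text \<open>
  A cocycle \<open>f\<close> vanishes on \<open>x - s (\<delta> x)\<close>, where \<open>s\<close> is the \<open>S\<close>-linear splitting, because this element
  is a boundary. Hence \<open>f = f \<circ> s \<circ> \<delta>\<close>, and \<open>f \<circ> s\<close> would bound \<open>f\<close> if it were \<open>G\<close>-equivariant. The
  map \<open>x \<mapsto> \<Sum>\<^bsub>g\<in>G\<^esub> g (r * f (s (g\<^sup>-\<^sup>1 x)))\<close> is equivariant, and composing it with the equivariant map \<open>\<delta>\<close>
  gives \<open>\<Sum>\<^bsub>g\<in>G\<^esub> g (r * g\<^sup>-\<^sup>1 (f x)) = tr r * f x\<close>.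
\<close>

lemma transfer_cocycle_coboundary:
  fixes P :: "nat \<Rightarrow> ('g \<Rightarrow> 'r, 'p) module"
  assumes res: "projective_resolution A P \<delta> \<epsilon> (trivial_module S G)"
    and r: "r \<in> carrier R" and f: "f \<in> Hom_cocycles A P \<delta> N (Suc n)"
  shows "(\<lambda>x\<in>carrier (P (Suc n)). group_ring_const S G (transfer r) \<odot>\<^bsub>N\<^esub> f x)
    \<in> Hom_coboundaries A P \<delta> N (Suc n)"
proof -
  obtain s where s: "linear_over scalars (P n) (P (Suc n)) s"
    and \<delta>s: "\<And>x. x \<in> carrier (P (Suc n)) \<Longrightarrow> \<delta> n (s (\<delta> n x)) = \<delta> n x"
    using resolution_splits_over_scalars[OF res, of n] by blast
  have "left_module A (P n)" "left_module A (P (Suc n))"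
    using res by (auto simp: projective_resolution_def projective_module_def)
  then interpret Pn: left_module A "P n" + Ps: left_module A "P (Suc n)" .
  have \<delta>: "linear_over (carrier A) (P (Suc n)) (P n) (\<delta> n)"
    using res by (intro mod_hom_linear_over[OF _ subset_refl]) (auto simp: projective_resolution_def)
  have exact: "\<delta> (Suc n) ` carrier (P (Suc (Suc n))) = {x \<in> carrier (P (Suc n)). \<delta> n x = \<zero>\<^bsub>P n\<^esub>}"
    using res by (auto simp: projective_resolution_def)
  have f_hom: "linear_over (carrier A) (P (Suc n)) N f"
    using f by (intro mod_hom_linear_over[OF _ subset_refl]) (auto simp: Hom_cocycles_def)
  have f_ker: "f x = \<zero>\<^bsub>R\<^esub>" if "x \<in> carrier (P (Suc n))" "\<delta> n x = \<zero>\<^bsub>P n\<^esub>" for x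
  proof -
    have "x \<in> \<delta> (Suc n) ` carrier (P (Suc (Suc n)))" using that exact by simp
    then show ?thesis using f by (auto simp: Hom_cocycles_def)
  qed
  note f_cl = linear_over_closed[OF f_hom, simplified]
    and f_add = linear_over_add[OF f_hom, simplified]
    and f_smult = linear_over_smult[OF f_hom]
    and s_cl = linear_over_closed[OF s] and \<delta>_cl = linear_over_closed[OF \<delta>]
  have one: "\<one>\<^bsub>R\<^esub> \<in> carrier S" using S.one_closed by simp
  note one_cl = single_closed[OF one]
  have fs\<delta>: "f (s (\<delta> n x)) = f x" if x: "x \<in> carrier (P (Suc n))" for x
  proof -
    let ?y = "s (\<delta> n x) \<oplus>\<^bsub>P (Suc n)\<^esub> \<ominus>\<^bsub>P (Suc n)\<^esub> x"
    have sx: "s (\<delta> n x) \<in> carrier (P (Suc n))" using x by (intro s_cl \<delta>_cl)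
    have "\<delta> n ?y = \<zero>\<^bsub>P n\<^esub>"
      using x sx \<delta>_cl linear_over_add[OF \<delta>] \<delta>s
        linear_over_minus[OF Ps.M.abelian_group_axioms Pn.M.abelian_group_axioms \<delta>]
      by (simp add: Pn.M.r_neg)
    then have "f ?y = \<zero>\<^bsub>R\<^esub>" using x sx by (intro f_ker) auto
    moreover have "f ?y = f (s (\<delta> n x)) \<oplus>\<^bsub>R\<^esub> \<ominus>\<^bsub>R\<^esub> f x"
      using x sx f_add f_cl linear_over_minus[OF Ps.M.abelian_group_axioms abelian_group_action_module f_hom]
      by (simp add: a_inv_action_module)
    ultimately show ?thesis
      using x sx f_cl by (metis R.a_inv_closed R.minus_equality R.minus_minus)
  qed
  define k where "k g x = act g (r \<otimes>\<^bsub>R\<^esub> f (s (single (inv\<^bsub>G\<^esub> g) \<one>\<^bsub>R\<^esub> \<odot>\<^bsub>P n\<^esub> x)))" for g x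
  define h where "h x = (\<Oplus>\<^bsub>R\<^esub>g\<in>carrier G. k g x)" for x
  have fs_cl: "f (s x) \<in> carrier R" if "x \<in> carrier (P n)" for x
    using that by (intro f_cl s_cl)
  have k_cl: "k g x \<in> carrier R" if "g \<in> carrier G" "x \<in> carrier (P n)" for g x
    unfolding k_def using that r by (intro act_closed R.m_closed fs_cl Pn.lsmult_closed one_cl)
  have k_add: "k g (x \<oplus>\<^bsub>P n\<^esub> y) = k g x \<oplus>\<^bsub>R\<^esub> k g y"
    if "g \<in> carrier G" "x \<in> carrier (P n)" "y \<in> carrier (P n)" for g x y
    using that r one_cl Pn.lsmult_closed s_cl f_cl
    by (simp add: k_def Pn.lsmult_r_distr linear_over_add[OF s] f_add R.r_distr
        ring_hom_add[OF act_hom])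
  have k_const: "k g (group_ring_const S G t \<odot>\<^bsub>P n\<^esub> x) = t \<otimes>\<^bsub>R\<^esub> k g x"
    if g: "g \<in> carrier G" and x: "x \<in> carrier (P n)" and t: "t \<in> carrier S" for g x t
  proof -
    let ?i = "single (inv\<^bsub>G\<^esub> g) \<one>\<^bsub>R\<^esub>" and ?t = "group_ring_const S G t"
    have ix: "?i \<odot>\<^bsub>P n\<^esub> x \<in> carrier (P n)" using x one_cl by (intro Pn.lsmult_closed)
    have tR: "t \<in> carrier R" "act g t = t" using t g by auto
    have "?i \<otimes>\<^bsub>A\<^esub> ?t = ?t \<otimes>\<^bsub>A\<^esub> ?i"
      using g one t by (simp add: single_mult_const del: invariant_ring_simps)
    then have "?i \<odot>\<^bsub>P n\<^esub> (?t \<odot>\<^bsub>P n\<^esub> x) = ?t \<odot>\<^bsub>P n\<^esub> (?i \<odot>\<^bsub>P n\<^esub> x)"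
      using x one_cl const_closed[OF t] by (metis Pn.lsmult_assoc)
    moreover have "f (s (?t \<odot>\<^bsub>P n\<^esub> (?i \<odot>\<^bsub>P n\<^esub> x))) = t \<otimes>\<^bsub>R\<^esub> f (s (?i \<odot>\<^bsub>P n\<^esub> x))"
      using linear_over_smult[OF s _ ix] f_smult[OF const_closed[OF t] s_cl[OF ix]]
        const_smult_action[OF t fs_cl[OF ix]] t by (simp del: action_module_simps(4))
    ultimately show ?thesis
      using g r tR fs_cl[OF ix] act_closed
      by (simp add: k_def R.m_lcomm[of r t] ring_hom_mult[OF act_hom])
  qed
  have k_grp: "k (g \<otimes>\<^bsub>G\<^esub> g') (single g \<one>\<^bsub>R\<^esub> \<odot>\<^bsub>P n\<^esub> x) = act g (k g' x)"
    if g: "g \<in> carrier G" "g' \<in> carrier G" and x: "x \<in> carrier (P n)" for g g' x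
  proof -
    have "inv\<^bsub>G\<^esub> (g \<otimes>\<^bsub>G\<^esub> g') \<otimes>\<^bsub>G\<^esub> g = inv\<^bsub>G\<^esub> g'"
      using g by (simp add: G.inv_mult_group G.m_assoc)
    then have "single (inv\<^bsub>G\<^esub> (g \<otimes>\<^bsub>G\<^esub> g')) \<one>\<^bsub>R\<^esub> \<otimes>\<^bsub>A\<^esub> single g \<one>\<^bsub>R\<^esub> = single (inv\<^bsub>G\<^esub> g') \<one>\<^bsub>R\<^esub>"
      using single_mult_single[OF _ g(1) one one, of "inv\<^bsub>G\<^esub> (g \<otimes>\<^bsub>G\<^esub> g')"] g by simp
    then have "single (inv\<^bsub>G\<^esub> (g \<otimes>\<^bsub>G\<^esub> g')) \<one>\<^bsub>R\<^esub> \<odot>\<^bsub>P n\<^esub> (single g \<one>\<^bsub>R\<^esub> \<odot>\<^bsub>P n\<^esub> x)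
        = single (inv\<^bsub>G\<^esub> g') \<one>\<^bsub>R\<^esub> \<odot>\<^bsub>P n\<^esub> x"
      using x one_cl by (metis Pn.lsmult_assoc)
    then show ?thesis
      using g r fs_cl[OF Pn.lsmult_closed[OF one_cl x]] by (simp add: k_def act_mult)
  qed
  have h: "restrict h (carrier (P n)) \<in> mod_hom A (P n) N"
  proof (rule mod_hom_actionI)
    fix x y assume "x \<in> carrier (P n)" "y \<in> carrier (P n)"
    then have "(\<Oplus>\<^bsub>R\<^esub>g\<in>carrier G. k g (x \<oplus>\<^bsub>P n\<^esub> y)) = (\<Oplus>\<^bsub>R\<^esub>g\<in>carrier G. k g x \<oplus>\<^bsub>R\<^esub> k g y)"
      by (intro R.finsum_cong') (auto simp: k_add k_cl)
    also have "\<dots> = h x \<oplus>\<^bsub>R\<^esub> h y"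
      unfolding h_def by (rule R.finsum_addf) (use k_cl \<open>x \<in> _\<close> \<open>y \<in> _\<close> in auto)
    finally show "h (x \<oplus>\<^bsub>P n\<^esub> y) = h x \<oplus>\<^bsub>R\<^esub> h y" by (simp add: h_def)
  next
    fix t x assume t: "t \<in> carrier S" and x: "x \<in> carrier (P n)"
    then have tR: "t \<in> carrier R" by simp
    have "(\<Oplus>\<^bsub>R\<^esub>g\<in>carrier G. k g (group_ring_const S G t \<odot>\<^bsub>P n\<^esub> x)) = (\<Oplus>\<^bsub>R\<^esub>g\<in>carrier G. t \<otimes>\<^bsub>R\<^esub> k g x)"
      by (intro R.finsum_cong'[OF refl] Pi_I R.m_closed tR k_cl k_const t x)
    also have "\<dots> = t \<otimes>\<^bsub>R\<^esub> h x"
      unfolding h_def using finite_acting_group tR k_cl x by (intro R.finsum_rdistr[symmetric]) auto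
    finally show "h (group_ring_const S G t \<odot>\<^bsub>P n\<^esub> x) = t \<otimes>\<^bsub>R\<^esub> h x" by (simp add: h_def)
  next
    fix g x assume g: "g \<in> carrier G" and x: "x \<in> carrier (P n)"
    interpret g: ring_hom_cring R R "act g" by (rule act_ring_hom_cring[OF g])
    let ?x = "single g \<one>\<^bsub>R\<^esub> \<odot>\<^bsub>P n\<^esub> x"
    have "h ?x = (\<Oplus>\<^bsub>R\<^esub>g'\<in>carrier G. k (g \<otimes>\<^bsub>G\<^esub> g') ?x)"
      unfolding h_def
      by (rule finsum_translate[OF g, symmetric]) (use k_cl Pn.lsmult_closed[OF one_cl x] in auto)
    also have "\<dots> = (\<Oplus>\<^bsub>R\<^esub>g'\<in>carrier G. act g (k g' x))"
      by (rule R.finsum_cong') (use g x k_grp k_cl act_closed in auto)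
    also have "\<dots> = act g (h x)"
      unfolding h_def using x k_cl by (subst g.hom_finsum) (auto simp: comp_def)
    finally show "h ?x = act g (h x)" .
  qed (auto simp: h_def k_cl intro!: R.finsum_closed Pn.left_module_axioms)
  have h\<delta>: "h (\<delta> n x) = group_ring_const S G (transfer r) \<odot>\<^bsub>N\<^esub> f x"
    if x: "x \<in> carrier (P (Suc n))" for x
  proof -
    have kx: "k g (\<delta> n x) = act g r \<otimes>\<^bsub>R\<^esub> f x" if g: "g \<in> carrier G" for g
    proof -
      let ?i = "single (inv\<^bsub>G\<^esub> g) \<one>\<^bsub>R\<^esub>"
      have ix: "?i \<odot>\<^bsub>P (Suc n)\<^esub> x \<in> carrier (P (Suc n))" by (rule Ps.lsmult_closed[OF one_cl x])
      have "f (s (?i \<odot>\<^bsub>P n\<^esub> \<delta> n x)) = f (?i \<odot>\<^bsub>P (Suc n)\<^esub> x)"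
        using linear_over_smult[OF \<delta> one_cl x] fs\<delta>[OF ix] by simp
      also have "\<dots> = act (inv\<^bsub>G\<^esub> g) (f x)"
        using f_smult[OF one_cl x] single_smult_action[OF _ one f_cl[OF x], of "inv\<^bsub>G\<^esub> g"] g
          act_closed f_cl[OF x] by (simp del: action_module_simps(4))
      finally have "k g (\<delta> n x) = act g (r \<otimes>\<^bsub>R\<^esub> act (inv\<^bsub>G\<^esub> g) (f x))" by (simp add: k_def)
      also have "\<dots> = act g r \<otimes>\<^bsub>R\<^esub> act g (act (inv\<^bsub>G\<^esub> g) (f x))"
        using g r f_cl[OF x] act_closed by (simp add: ring_hom_mult[OF act_hom])
      also have "act g (act (inv\<^bsub>G\<^esub> g) (f x)) = f x"
        using g f_cl[OF x] by (simp flip: act_mult add: act_one)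
      finally show ?thesis .
    qed
    have "h (\<delta> n x) = (\<Oplus>\<^bsub>R\<^esub>g\<in>carrier G. act g r \<otimes>\<^bsub>R\<^esub> f x)"
      unfolding h_def by (rule R.finsum_cong') (use kx r act_closed f_cl[OF x] in auto)
    also have "\<dots> = transfer r \<otimes>\<^bsub>R\<^esub> f x"
      unfolding transfer_def using finite_acting_group r act_closed f_cl[OF x]
      by (intro R.finsum_ldistr[symmetric]) auto
    finally show ?thesis
      using const_smult_action[OF transfer_closed[OF r] f_cl[OF x]] by simp
  qed
  show ?thesis
    unfolding Hom_coboundaries.simps
  proof (rule image_eqI[OF _ h], rule restrict_ext)
    fix x assume x: "x \<in> carrier (P (Suc n))"
    show "group_ring_const S G (transfer r) \<odot>\<^bsub>N\<^esub> f x = restrict h (carrier (P n)) (\<delta> n x)"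
      using h\<delta>[OF x] \<delta>_cl[OF x] by simp
  qed
qed

end

context ring_action
begin

lemma mod_hom_action_add:
  assumes P: "left_module A P" and f: "f \<in> mod_hom A P N" and g: "g \<in> mod_hom A P N"
  shows "(\<lambda>x\<in>carrier P. f x \<oplus>\<^bsub>R\<^esub> g x) \<in> mod_hom A P N"
proof -
  interpret P: left_module A P by fact
  have cl: "f x \<in> carrier R" "g x \<in> carrier R" if "x \<in> carrier P" for x
    using f g that by (auto simp: mod_hom_def)
  show ?thesis
    using f g by (auto simp: mod_hom_def P.lsmult_closed cl R.a_ac smult_action_add[simplified])
qed

lemma mod_hom_action_neg:
  assumes P: "left_module A P" and f: "f \<in> mod_hom A P N"
  shows "(\<lambda>x\<in>carrier P. \<ominus>\<^bsub>R\<^esub> f x) \<in> mod_hom A P N"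
proof -
  interpret P: left_module A P by fact
  have cl: "f x \<in> carrier R" if "x \<in> carrier P" for x
    using f that by (auto simp: mod_hom_def)
  have "a \<odot>\<^bsub>N\<^esub> (\<ominus>\<^bsub>R\<^esub> r) = \<ominus>\<^bsub>R\<^esub> (a \<odot>\<^bsub>N\<^esub> r)" if a: "a \<in> carrier A" and r: "r \<in> carrier R" for a r
  proof -
    have "linear_over {} N N (\<lambda>r. a \<odot>\<^bsub>N\<^esub> r)"
      by (rule linear_overI) (use a smult_action_closed smult_action_add in auto)
    from linear_over_minus[OF abelian_group_action_module abelian_group_action_module this]
    show ?thesis using r smult_action_closed[OF a r] by (simp add: a_inv_action_module)
  qed
  then show ?thesis
    using f by (auto simp: mod_hom_def P.lsmult_closed cl R.minus_add)
qed

text \<open>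
  What remains is to pass from cocycles to classes, that is, to cosets of the coboundaries.
\<close>

theorem transfer_annihilates_cohomology:
  fixes P :: "nat \<Rightarrow> ('g \<Rightarrow> 'r, 'p) module"
  assumes res: "projective_resolution A P \<delta> \<epsilon> (trivial_module S G)"
    and r: "r \<in> carrier R" and i: "i \<ge> 1"
  shows "transfer r \<in> annihilator S (group_cohomology S G P \<delta> N i)"
proof -
  obtain n where n: "i = Suc n" using i by (cases i) auto
  let ?Z = "Hom_cocycles A P \<delta> N i" and ?U = "Hom_coboundaries A P \<delta> N i"
  let ?M = "(Hom_module (group_ring_const S G) A (P i) N)\<lparr>carrier := ?Z\<rparr>"
  have lm: "left_module A (P j)" for j
    using res by (auto simp: projective_resolution_def projective_module_def)
  have \<delta>: "\<delta> j \<in> mod_hom A (P (Suc j)) (P j)" for j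
    using res by (auto simp: projective_resolution_def)
  have \<delta>_cl: "\<delta> j x \<in> carrier (P j)" if "x \<in> carrier (P (Suc j))" for j x
    using \<delta>[of j] that by (auto simp: mod_hom_def)
  have \<delta>\<delta>: "\<delta> n (\<delta> i x) = \<zero>\<^bsub>P n\<^esub>" if "x \<in> carrier (P (Suc i))" for x
    using res that unfolding projective_resolution_def n by blast
  have add_M: "f \<oplus>\<^bsub>?M\<^esub> g = (\<lambda>x\<in>carrier (P i). f x \<oplus>\<^bsub>R\<^esub> g x)" for f g
    by (simp add: Hom_module_def)
  have coset: "?U +>\<^bsub>?M\<^esub> f = {u \<oplus>\<^bsub>?M\<^esub> f |u. u \<in> ?U}" for f
    by (auto simp: a_r_coset_def')
  have hom_cl: "f x \<in> carrier R" if "f \<in> mod_hom A (P j) N" "x \<in> carrier (P j)" for f j x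
    using that by (auto simp: mod_hom_def)
  have Z_hom: "f \<in> mod_hom A (P i) N" if "f \<in> ?Z" for f
    using that by (simp add: Hom_cocycles_def)
  have U_eq: "?U = (\<lambda>h. \<lambda>x\<in>carrier (P i). h (\<delta> n x)) ` mod_hom A (P n) N"
    by (simp add: n)
  have U_add: "u \<oplus>\<^bsub>?M\<^esub> v \<in> ?U" if uv: "u \<in> ?U" "v \<in> ?U" for u v
  proof -
    obtain h k where h: "h \<in> mod_hom A (P n) N" "k \<in> mod_hom A (P n) N"
      and "u = (\<lambda>x\<in>carrier (P i). h (\<delta> n x))" "v = (\<lambda>x\<in>carrier (P i). k (\<delta> n x))"
      using uv unfolding U_eq image_iff Bex_def by blast
    then show ?thesis
      unfolding U_eq add_M using \<delta>_cl
      by (intro image_eqI[OF _ mod_hom_action_add[OF lm h]]) (auto simp: fun_eq_iff n)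
  qed
  have U_neg: "(\<lambda>x\<in>carrier (P i). \<ominus>\<^bsub>R\<^esub> u x) \<in> ?U" if u: "u \<in> ?U" for u
  proof -
    obtain h where h: "h \<in> mod_hom A (P n) N" and "u = (\<lambda>x\<in>carrier (P i). h (\<delta> n x))"
      using u unfolding U_eq image_iff Bex_def by blast
    then show ?thesis
      unfolding U_eq using \<delta>_cl
      by (intro image_eqI[OF _ mod_hom_action_neg[OF lm h]]) (auto simp: fun_eq_iff n)
  qed
  have U_val: "u x \<in> carrier R" if "u \<in> ?U" "x \<in> carrier (P i)" for u x
    using that \<delta>_cl hom_cl unfolding U_eq n by auto
  have U_Z: "u \<oplus>\<^bsub>?M\<^esub> f \<in> ?Z" if u: "u \<in> ?U" and f: "f \<in> ?Z" for u f
  proof -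
    obtain h where h: "h \<in> mod_hom A (P n) N" "u = (\<lambda>x\<in>carrier (P i). h (\<delta> n x))"
      using u unfolding U_eq image_iff Bex_def by blast
    have "left_module A (P n)" "left_module A (P i)" by (rule lm)+
    then interpret Pn: left_module A "P n" + Pi: left_module A "P i" .
    have "linear_over {} (P n) N h" using h by (auto simp: mod_hom_def linear_over_def)
    from linear_over_zero[OF Pn.M.abelian_group_axioms abelian_group_action_module this]
    have h0: "h \<zero>\<^bsub>P n\<^esub> = \<zero>\<^bsub>R\<^esub>" by simp
    have "u \<in> mod_hom A (P i) N"
      using h \<delta>[of n] \<delta>_cl by (auto simp: mod_hom_def n Pi.lsmult_closed[unfolded n] Pi.M.a_closed[unfolded n])
    then have "(\<lambda>x\<in>carrier (P i). u x \<oplus>\<^bsub>R\<^esub> f x) \<in> mod_hom A (P i) N"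
      by (rule mod_hom_action_add[OF lm _ Z_hom[OF f]])
    moreover have "u (\<delta> i x) = \<zero>\<^bsub>R\<^esub>" if "x \<in> carrier (P (Suc i))" for x
      using that h(2) h0 \<delta>_cl \<delta>\<delta> by simp
    ultimately show ?thesis
      using f \<delta>_cl[of _ i] unfolding add_M by (simp add: Hom_cocycles_def)
  qed
  have U_coset: "?U +>\<^bsub>?M\<^esub> u = ?U" if u: "u \<in> ?U" for u
  proof (intro equalityI subsetI)
    fix w assume w: "w \<in> ?U"
    have "w = (w \<oplus>\<^bsub>?M\<^esub> (\<lambda>x\<in>carrier (P i). \<ominus>\<^bsub>R\<^esub> u x)) \<oplus>\<^bsub>?M\<^esub> u"
    proof
      fix x
      have "w \<in> extensional (carrier (P i))" using w unfolding U_eq by auto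
      then show "w x = ((w \<oplus>\<^bsub>?M\<^esub> (\<lambda>x\<in>carrier (P i). \<ominus>\<^bsub>R\<^esub> u x)) \<oplus>\<^bsub>?M\<^esub> u) x"
        using U_val[OF u] U_val[OF w] unfolding add_M
        by (auto simp: R.a_assoc R.l_neg extensional_def)
    qed
    then show "w \<in> ?U +>\<^bsub>?M\<^esub> u"
      unfolding coset using U_add[OF w U_neg[OF u]] by blast
  qed (use U_add u in \<open>auto simp: coset\<close>)
  have zero_U: "(\<lambda>x\<in>carrier (P i). \<zero>\<^bsub>R\<^esub>) \<in> ?U"
  proof -
    have "left_module A (P n)" by (rule lm)
    then interpret Pn: left_module A "P n" .
    have z: "(\<lambda>x\<in>carrier (P n). \<zero>\<^bsub>R\<^esub>) \<in> mod_hom A (P n) N"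
      by (rule mod_hom_actionI[OF lm]) (auto simp: ring_hom_zero[OF act_hom R.ring_axioms R.ring_axioms])
    show ?thesis
      unfolding U_eq using \<delta>_cl by (intro image_eqI[OF _ z]) (auto simp: fun_eq_iff n)
  qed
  have kill: "transfer r \<odot>\<^bsub>quotient_module ?M ?U\<^esub> D = ?U" if D: "D \<in> a_rcosets\<^bsub>?M\<^esub> ?U" for D
  proof -
    obtain f where f: "f \<in> ?Z" "D = ?U +>\<^bsub>?M\<^esub> f"
      using D by (auto simp: A_RCOSETS_def')
    have "x \<in> ?Z" if "x \<in> D" for x
      using that U_Z f unfolding f(2) coset by auto
    then have "transfer r \<odot>\<^bsub>?M\<^esub> x \<in> ?U" if "x \<in> D" for x
      using transfer_cocycle_coboundary[OF res r, of x n] that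
      by (simp add: Hom_module_def n del: Hom_coboundaries.simps action_module_simps)
    then have "?U +>\<^bsub>?M\<^esub> (transfer r \<odot>\<^bsub>?M\<^esub> x) = ?U" if "x \<in> D" for x
      using that U_coset by blast
    moreover have "D \<noteq> {}" using zero_U unfolding f(2) coset by auto
    ultimately have "(\<Union>x\<in>D. ?U +>\<^bsub>?M\<^esub> (transfer r \<odot>\<^bsub>?M\<^esub> x)) = ?U" by auto
    then show ?thesis by (simp add: quotient_module_def)
  qed
  then show ?thesis
    using transfer_closed[OF r]
    unfolding annihilator_def group_cohomology_def Ext_module_def
    by (auto simp: quotient_module_def)
qed

corollary radical_annihilator_of_transfer_power:
  fixes P :: "nat \<Rightarrow> ('g \<Rightarrow> 'r, 'p) module"
  assumes "projective_resolution A P \<delta> \<epsilon> (trivial_module S G)" and "i \<ge> 1"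
    and "d \<in> carrier S" and "r \<in> carrier R" and "d [^]\<^bsub>R\<^esub> (m :: nat) = transfer r"
  shows "d \<in> ideal_radical S (annihilator S (group_cohomology S G P \<delta> N i))"
proof -
  have "d [^]\<^bsub>S\<^esub> m = transfer r"
    using assms(5) by (simp add: nat_pow_def)
  then show ?thesis
    using transfer_annihilates_cohomology[OF assms(1,4,2)] assms(3)
    unfolding ideal_radical_def by (metis (mono_tags, lifting) CollectI)
qed

end

section \<open>Powers that are transfers\<close>

text \<open>
  The action is by ring endomorphisms of a whole type, but only the elements of the \<open>G\<close>-stable
  subring \<open>Q\<close> matter: for the application the type contains polynomials in all functions on the
  vector space, and \<open>Q\<close> those in the linear forms.
\<close>

locale subring_action = G: group G for G :: "'g monoid" +
  fixes act :: "'g \<Rightarrow> 'a::comm_ring_1 \<Rightarrow> 'a" and Q :: "'a set"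
  assumes finite_acting: "finite (carrier G)"
    and act_add: "g \<in> carrier G \<Longrightarrow> act g (x + y) = act g x + act g y"
    and act_times: "g \<in> carrier G \<Longrightarrow> act g (x * y) = act g x * act g y"
    and act_1: "g \<in> carrier G \<Longrightarrow> act g 1 = 1"
    and act_comp: "\<lbrakk>g \<in> carrier G; h \<in> carrier G\<rbrakk> \<Longrightarrow> act (g \<otimes>\<^bsub>G\<^esub> h) x = act g (act h x)"
    and act_id: "act \<one>\<^bsub>G\<^esub> x = x"
    and Q_one: "1 \<in> Q" and Q_diff: "\<lbrakk>x \<in> Q; y \<in> Q\<rbrakk> \<Longrightarrow> x - y \<in> Q"
    and Q_mult: "\<lbrakk>x \<in> Q; y \<in> Q\<rbrakk> \<Longrightarrow> x * y \<in> Q"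
    and Q_act: "\<lbrakk>g \<in> carrier G; x \<in> Q\<rbrakk> \<Longrightarrow> act g x \<in> Q"
begin

lemma Q_zero: "0 \<in> Q"
  using Q_diff[OF Q_one Q_one] by simp

lemma Q_uminus: "x \<in> Q \<Longrightarrow> - x \<in> Q"
  using Q_diff[OF Q_zero, of x] by simp

lemma Q_add: "\<lbrakk>x \<in> Q; y \<in> Q\<rbrakk> \<Longrightarrow> x + y \<in> Q"
  using Q_diff[OF _ Q_uminus, of x y] by simp

lemma Q_sum: "(\<And>i. i \<in> B \<Longrightarrow> f i \<in> Q) \<Longrightarrow> sum f B \<in> Q"
  by (induction B rule: infinite_finite_induct) (auto intro: Q_zero Q_add)

lemma Q_prod: "(\<And>i. i \<in> B \<Longrightarrow> f i \<in> Q) \<Longrightarrow> prod f B \<in> Q"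
  by (induction B rule: infinite_finite_induct) (auto intro: Q_one Q_mult)

lemma Q_power: "x \<in> Q \<Longrightarrow> x ^ n \<in> Q"
  by (induction n) (auto intro: Q_one Q_mult)

lemma act_zero: "g \<in> carrier G \<Longrightarrow> act g 0 = 0"
  using act_add[of g 0 0] by simp

lemma act_diff: "g \<in> carrier G \<Longrightarrow> act g (x - y) = act g x - act g y"
  using act_add[of g "x - y" y] by simp

lemma act_sum: "g \<in> carrier G \<Longrightarrow> act g (sum f B) = (\<Sum>i\<in>B. act g (f i))"
  by (induction B rule: infinite_finite_induct) (auto simp: act_zero act_add)

lemma act_prod: "g \<in> carrier G \<Longrightarrow> act g (prod f B) = (\<Prod>i\<in>B. act g (f i))"
  by (induction B rule: infinite_finite_induct) (auto simp: act_1 act_times)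

lemma act_power: "g \<in> carrier G \<Longrightarrow> act g (x ^ n) = act g x ^ n"
  by (induction n) (auto simp: act_1 act_times)

lemma translate_bij: "k \<in> carrier G \<Longrightarrow> bij_betw (\<lambda>g. k \<otimes>\<^bsub>G\<^esub> g) (carrier G) (carrier G)"
  by (rule bij_betw_byWitness[where f' = "\<lambda>g. inv\<^bsub>G\<^esub> k \<otimes>\<^bsub>G\<^esub> g"])
    (auto simp: G.m_assoc[symmetric])

definition trace :: "'a \<Rightarrow> 'a" where "trace y = (\<Sum>g\<in>carrier G. act g y)"

definition orbit_prod :: "'a \<Rightarrow> 'a" where "orbit_prod a = (\<Prod>g\<in>carrier G. act g a)"

definition invariants :: "'a set" where "invariants = {s \<in> Q. \<forall>g\<in>carrier G. act g s = s}"

lemma trace_invariant: "y \<in> Q \<Longrightarrow> trace y \<in> invariants"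
proof -
  assume y: "y \<in> Q"
  have "act k (trace y) = trace y" if k: "k \<in> carrier G" for k
  proof -
    have "act k (trace y) = (\<Sum>g\<in>carrier G. act (k \<otimes>\<^bsub>G\<^esub> g) y)"
      using k by (simp add: trace_def act_sum act_comp)
    also have "\<dots> = trace y"
      unfolding trace_def by (rule sum.reindex_bij_betw[OF translate_bij[OF k]])
    finally show ?thesis .
  qed
  then show ?thesis
    using y by (auto simp: invariants_def trace_def intro: Q_sum Q_act)
qed

lemma trace_diff: "trace x - trace y = trace (x - y)"
  by (simp add: trace_def act_diff sum_subtractf)

lemma trace_mult_invariant: "s \<in> invariants \<Longrightarrow> s * trace y = trace (s * y)"
  by (simp add: trace_def invariants_def act_times sum_distrib_left)

text \<open>
  The orbit product of \<open>a + b t\<close> is \<open>\<Prod>\<^bsub>g\<in>G\<^esub> (g a + g b * t)\<close>, a polynomial in \<open>t\<close> with constant term the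
  orbit product of \<open>a\<close>. Its coefficients are sums over sets \<open>B\<close> of group elements of given
  cardinality, and translation by a group element permutes these sets; so they are invariant.
\<close>

lemma orbit_prod_add_mult_invariant:
  assumes a: "a \<in> Q" and b: "b \<in> Q" and t: "t \<in> invariants"
  obtains s where "s \<in> invariants" "orbit_prod (a + b * t) = orbit_prod a + t * s"
proof -
  let ?G = "carrier G"
  define F where "F B = (\<Prod>g\<in>B. act g b) * (\<Prod>g\<in>?G - B. act g a)" for B
  define s where "s = (\<Sum>B\<in>Pow ?G - {{}}. t ^ (card B - 1) * F B)"
  have fin: "finite B" if "B \<subseteq> ?G" for B using that finite_acting by (rule finite_subset)
  have at: "act g t = t" if "g \<in> ?G" for g using t that by (simp add: invariants_def)
  have "orbit_prod (a + b * t) = (\<Prod>g\<in>?G. act g b * t + act g a)"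
    by (simp add: orbit_prod_def act_add act_times at add.commute)
  also have "\<dots> = (\<Sum>B\<in>Pow ?G. (\<Prod>g\<in>B. act g b * t) * (\<Prod>g\<in>?G - B. act g a))"
    by (rule prod_add[OF finite_acting])
  also have "\<dots> = (\<Sum>B\<in>Pow ?G. t ^ card B * F B)"
    by (rule sum.cong) (auto simp: F_def prod.distrib fin ac_simps)
  also have "\<dots> = F {} + (\<Sum>B\<in>Pow ?G - {{}}. t ^ card B * F B)"
    using finite_acting by (subst sum.remove[of _ "{}"]) auto
  also have "(\<Sum>B\<in>Pow ?G - {{}}. t ^ card B * F B) = t * s"
    unfolding s_def sum_distrib_left
  proof (rule sum.cong[OF refl])
    fix B assume "B \<in> Pow ?G - {{}}"
    then have "card B = Suc (card B - 1)" using fin[of B] by (auto simp: card_gt_0_iff)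
    then show "t ^ card B * F B = t * (t ^ (card B - 1) * F B)"
      by (metis mult.assoc power_Suc)
  qed
  also have "F {} = orbit_prod a" by (simp add: F_def orbit_prod_def)
  finally have eq: "orbit_prod (a + b * t) = orbit_prod a + t * s" .
  have "s \<in> Q"
    unfolding s_def F_def using a b t
    by (intro Q_sum Q_mult Q_prod Q_power Q_act) (auto simp: invariants_def)
  moreover have "act k s = s" if k: "k \<in> ?G" for k
  proof -
    let ?m = "\<lambda>g. k \<otimes>\<^bsub>G\<^esub> g"
    have inj: "inj_on ?m ?G" and im: "?m ` ?G = ?G"
      using translate_bij[OF k] by (auto simp: bij_betw_def)
    have injB: "inj_on ?m B" if "B \<subseteq> ?G" for B using inj that by (rule inj_on_subset)
    have shift: "act k (F B) = F (?m ` B)" if B: "B \<subseteq> ?G" for B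
    proof -
      have p: "act k (\<Prod>g\<in>D. act g x) = (\<Prod>g\<in>?m ` D. act g x)" if "D \<subseteq> ?G" for D x
        using that k injB[OF that]
        by (auto simp: act_prod prod.reindex subset_iff act_comp intro!: prod.cong)
      have "?m ` (?G - B) = ?G - ?m ` B"
        using inj_on_image_set_diff[OF inj _ B, of ?G] im by auto
      then show ?thesis using k p[OF B] p[of "?G - B"] by (simp add: F_def act_times)
    qed
    have "act k s = (\<Sum>B\<in>Pow ?G - {{}}. t ^ (card (?m ` B) - 1) * F (?m ` B))"
      unfolding s_def using k
      by (auto simp: act_sum act_times act_power at shift card_image[OF injB] intro!: sum.cong)
    also have "\<dots> = s"
      unfolding s_def
    proof (rule sum.reindex_bij_betw)
      have "bij_betw ((`) ?m) (Pow ?G) (Pow ?G)"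
        by (rule bij_betw_Pow) (rule translate_bij[OF k])
      then show "bij_betw ((`) ?m) (Pow ?G - {{}}) (Pow ?G - {{}})"
        by (rule bij_betw_DiffI) auto
    qed
    finally show ?thesis .
  qed
  ultimately show thesis using that[of s] eq by (auto simp: invariants_def)
qed

text \<open>
  The elements that do not change orbit products modulo transfers. They are closed under subtraction
  and contain all \<open>Q\<close>-multiples of transfers, which makes them a substitute for the ideal of \<open>Q\<close>
  generated by the transfers: that an element of this ideal has a transfer as orbit product is the
  case \<open>a = 0\<close>, whereas general \<open>a\<close> is what makes the closure under subtraction evident.
\<close>

definition negligible :: "'a set"
  where "negligible = {D \<in> Q. \<forall>a\<in>Q. orbit_prod (a + D) - orbit_prod a \<in> trace ` Q}"

lemma negligible_diff:
  assumes D: "D \<in> negligible" and E: "E \<in> negligible"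
  shows "D - E \<in> negligible"
proof -
  have Q: "D \<in> Q" "E \<in> Q" using D E by (auto simp: negligible_def)
  have "orbit_prod (a + (D - E)) - orbit_prod a \<in> trace ` Q" if a: "a \<in> Q" for a
  proof -
    obtain x where x: "x \<in> Q" "orbit_prod (a + D) - orbit_prod a = trace x"
      using D a by (auto simp: negligible_def)
    have "a + (D - E) \<in> Q" using a Q by (intro Q_add Q_diff)
    then have "orbit_prod ((a + (D - E)) + E) - orbit_prod (a + (D - E)) \<in> trace ` Q"
      using E unfolding negligible_def by blast
    then obtain y where y: "y \<in> Q" "orbit_prod (a + D) - orbit_prod (a + (D - E)) = trace y"
      by (auto simp: algebra_simps)
    have "orbit_prod (a + (D - E)) - orbit_prod a = trace (x - y)"
      unfolding trace_diff[symmetric] x(2)[symmetric] y(2)[symmetric] by simp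
    then show ?thesis using Q_diff[OF x(1) y(1)] by blast
  qed
  then show ?thesis using Q by (auto simp: negligible_def Q_diff)
qed

lemma multiple_of_trace_negligible:
  assumes "c \<in> Q" "y \<in> Q"
  shows "c * trace y \<in> negligible"
proof -
  have t: "trace y \<in> invariants" by (rule trace_invariant) fact
  have "orbit_prod (a + c * trace y) - orbit_prod a \<in> trace ` Q" if a: "a \<in> Q" for a
  proof -
    obtain s where s: "s \<in> invariants" "orbit_prod (a + c * trace y) = orbit_prod a + trace y * s"
      using orbit_prod_add_mult_invariant[OF a assms(1) t] .
    then have "orbit_prod (a + c * trace y) - orbit_prod a = trace (s * y)"
      by (simp add: trace_mult_invariant[symmetric] mult.commute)
    then show ?thesis using s assms by (auto simp: invariants_def intro: Q_mult)
  qed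
  then show ?thesis
    using assms t by (auto simp: negligible_def invariants_def intro: Q_mult)
qed

text \<open>
  Expanding the factor for \<open>k\<close>: the summand \<open>h (v\<^sub>k)\<close> is absorbed into \<open>h y\<close>, and the summand
  \<open>k (v\<^sub>k)\<close>, independent of \<open>h\<close>, is absorbed into \<open>c\<close>. For empty \<open>B\<close> the sum is \<open>c\<close> times the trace of
  \<open>y\<close>.
\<close>

lemma sum_prod_differences_negligible:
  assumes v: "\<And>g. g \<in> carrier G \<Longrightarrow> v g \<in> Q" and B: "B \<subseteq> carrier G"
    and cy: "c \<in> Q" "y \<in> Q"
  shows "(\<Sum>h\<in>carrier G. c * act h y * (\<Prod>g\<in>B. act h (v g) - act g (v g))) \<in> negligible"
proof -
  have "finite B" using B finite_acting by (rule finite_subset)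
  then show ?thesis
    using B cy
  proof (induction B arbitrary: c y)
    case empty
    then show ?case
      using multiple_of_trace_negligible by (simp add: trace_def sum_distrib_left)
  next
    case (insert k B)
    let ?\<Pi> = "\<lambda>h. \<Prod>g\<in>B. act h (v g) - act g (v g)"
    have k: "k \<in> carrier G" using insert by simp
    have "(\<Sum>h\<in>carrier G. c * act h y * (\<Prod>g\<in>insert k B. act h (v g) - act g (v g)))
        = (\<Sum>h\<in>carrier G. c * act h (y * v k) * ?\<Pi> h)
          - (\<Sum>h\<in>carrier G. (c * act k (v k)) * act h y * ?\<Pi> h)"
      using insert.hyps by (simp add: sum_subtractf[symmetric] act_times algebra_simps)
    then show ?case
      using insert k v by (auto intro!: negligible_diff insert.IH Q_mult Q_act)
  qed
qed

text \<open>
  Modulo \<open>J\<close> every \<open>g \<noteq> 1\<close> acts without fixed points outside the zeros of \<open>d\<close>, since \<open>v - g v\<close> divides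
  \<open>d\<close>. The exponent that the proof yields is \<open>(|G| - 1) |G|\<close>.
\<close>

theorem power_congruent_trace:
  assumes J_zero: "0 \<in> J" and J_add: "\<And>x y. \<lbrakk>x \<in> J; y \<in> J\<rbrakk> \<Longrightarrow> x + y \<in> J"
    and J_mult: "\<And>x y. \<lbrakk>x \<in> Q; y \<in> J\<rbrakk> \<Longrightarrow> x * y \<in> J"
    and J_act: "\<And>g x. \<lbrakk>g \<in> carrier G; x \<in> J\<rbrakk> \<Longrightarrow> act g x \<in> J" and J_Q: "J \<subseteq> Q"
    and d: "d \<in> invariants"
    and v: "\<And>g. g \<in> carrier G \<Longrightarrow> g \<noteq> \<one>\<^bsub>G\<^esub> \<Longrightarrow> \<exists>v\<in>Q. \<exists>e\<in>Q. d - (v - act g v) * e \<in> J"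
  shows "\<exists>r\<in>Q. \<exists>m. d ^ m - trace r \<in> J"
proof -
  let ?G' = "carrier G - {\<one>\<^bsub>G\<^esub>}"
  have dQ: "d \<in> Q" using d by (simp add: invariants_def)
  have cong_prod: "prod f B - prod f' B \<in> J"
    if "\<And>i. i \<in> B \<Longrightarrow> f i - f' i \<in> J" "\<And>i. i \<in> B \<Longrightarrow> f i \<in> Q" "\<And>i. i \<in> B \<Longrightarrow> f' i \<in> Q"
    for f f' :: "'g \<Rightarrow> 'a" and B
    using that
  proof (induction B rule: infinite_finite_induct)
    case (insert i B)
    have "prod f (insert i B) - prod f' (insert i B)
        = f i * (prod f B - prod f' B) + prod f' B * (f i - f' i)"
      using insert.hyps by (simp add: algebra_simps)
    then show ?case using insert by (auto intro!: J_add J_mult Q_prod)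
  qed (auto simp: J_zero)
  have "\<forall>g\<in>?G'. \<exists>p. fst p \<in> Q \<and> snd p \<in> Q \<and> d - (fst p - act g (fst p)) * snd p \<in> J"
    using v by force
  then obtain p where p: "\<forall>g\<in>?G'. fst (p g) \<in> Q \<and> snd (p g) \<in> Q \<and>
      d - (fst (p g) - act g (fst (p g))) * snd (p g) \<in> J"
    by (rule bchoice[THEN exE])
  define v where "v g = fst (p g)" for g
  define e where "e g = snd (p g)" for g
  have ve: "v g \<in> Q" "e g \<in> Q" "d - (v g - act g (v g)) * e g \<in> J" if "g \<in> carrier G" "g \<noteq> \<one>\<^bsub>G\<^esub>" for g
    using p that by (auto simp: v_def e_def)
  \<comment> \<open>a total choice of elements of \<open>Q\<close>; the value at the neutral element is arbitrary\<close>
  define v' where "v' g = (if g = \<one>\<^bsub>G\<^esub> then 1 else v g)" for g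
  define D where "D = (\<Prod>g\<in>?G'. (v g - act g (v g)) * e g)"
  have "(\<Sum>h\<in>carrier G. (\<Prod>g\<in>?G'. e g) * act h 1 * (\<Prod>g\<in>?G'. act h (v' g) - act g (v' g)))
      \<in> negligible"
  proof (rule sum_prod_differences_negligible)
    show "(\<Prod>g\<in>?G'. e g) \<in> Q" by (rule Q_prod) (use ve in blast)
  qed (use ve Q_one in \<open>auto simp: v'_def\<close>)
  also have "(\<Sum>h\<in>carrier G. (\<Prod>g\<in>?G'. e g) * act h 1 * (\<Prod>g\<in>?G'. act h (v' g) - act g (v' g)))
      = (\<Sum>h\<in>{\<one>\<^bsub>G\<^esub>}. (\<Prod>g\<in>?G'. e g) * (\<Prod>g\<in>?G'. act h (v' g) - act g (v' g)))"
  proof (rule sum.mono_neutral_cong_right[OF finite_acting])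
    \<comment> \<open>the factor for \<open>g = h\<close> vanishes\<close>
    show "\<forall>h\<in>carrier G - {\<one>\<^bsub>G\<^esub>}.
        (\<Prod>g\<in>?G'. e g) * act h 1 * (\<Prod>g\<in>?G'. act h (v' g) - act g (v' g)) = 0"
    proof
      fix h assume h: "h \<in> carrier G - {\<one>\<^bsub>G\<^esub>}"
      then have "(\<Prod>g\<in>?G'. act h (v' g) - act g (v' g)) = 0"
        using finite_acting by (intro prod_zero) (auto intro!: bexI[of _ h])
      then show "(\<Prod>g\<in>?G'. e g) * act h 1 * (\<Prod>g\<in>?G'. act h (v' g) - act g (v' g)) = 0"
        by simp
    qed
  qed (auto simp: act_1)
  also have "\<dots> = D"
    by (simp add: D_def v'_def act_id prod.distrib mult.commute)
  finally have D: "D \<in> negligible" .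
  have n0: "orbit_prod 0 = 0"
    using finite_acting G.one_closed unfolding orbit_prod_def by (intro prod_zero) (auto simp: act_zero)
  obtain r where r: "r \<in> Q" "orbit_prod D = trace r"
    using D Q_zero n0 by (force simp: negligible_def)
  have DQ: "D \<in> Q" using D by (simp add: negligible_def)
  have D_cong: "d ^ card ?G' - D \<in> J"
    using cong_prod[of ?G' "\<lambda>_. d" "\<lambda>g. (v g - act g (v g)) * e g"] ve dQ
    by (simp add: D_def Q_mult Q_diff Q_act)
  have "act h (d ^ card ?G') - act h D \<in> J" if "h \<in> carrier G" for h
    using J_act[OF that D_cong] that by (simp add: act_diff)
  then have "orbit_prod (d ^ card ?G') - orbit_prod D \<in> J"
    unfolding orbit_prod_def using dQ DQ by (intro cong_prod) (auto intro: Q_act Q_power)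
  moreover have "orbit_prod (d ^ card ?G') = (d ^ card ?G') ^ card (carrier G)"
    using d by (simp add: orbit_prod_def act_power invariants_def)
  ultimately show ?thesis using r by (metis power_mult)
qed

end

section \<open>Substitution in polynomials\<close>

text \<open>
  The value of a monomial under a substitution; \<open>psubst\<close> is additive, and multiplicativity reduces to
  that of this map.
\<close>

definition psubst_monom :: "('x \<Rightarrow> ('y, 'k::comm_ring_1) mpoly) \<Rightarrow> ('x \<Rightarrow>\<^sub>0 nat) \<Rightarrow> ('y, 'k) mpoly"
  where "psubst_monom f m = (\<Prod>x\<in>Poly_Mapping.keys m. f x ^ Poly_Mapping.lookup m x)"

lemma psubst_eq: "psubst f p =
    (\<Sum>m\<in>Poly_Mapping.keys p. pconst (Poly_Mapping.lookup p m) * psubst_monom f m)"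
  by (simp add: psubst_def psubst_monom_def)

lemma pconst_simps: "pconst 0 = 0" "pconst 1 = 1"
  "pconst (a + b) = pconst a + pconst b" "pconst (a * b) = pconst a * pconst b"
  by (simp_all add: pconst_def single_add mult_single)

lemma psubst_monom_superset:
  "\<lbrakk>finite B; Poly_Mapping.keys m \<subseteq> B\<rbrakk> \<Longrightarrow> psubst_monom f m = (\<Prod>x\<in>B. f x ^ Poly_Mapping.lookup m x)"
  unfolding psubst_monom_def
  by (rule prod.mono_neutral_left) (auto simp: in_keys_iff)

lemma psubst_monom_add: "psubst_monom f (m + n) = psubst_monom f m * psubst_monom f n"
proof -
  let ?B = "Poly_Mapping.keys m \<union> Poly_Mapping.keys n"
  have "psubst_monom f (m + n) = (\<Prod>x\<in>?B. f x ^ Poly_Mapping.lookup (m + n) x)"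
    by (rule psubst_monom_superset) (use keys_add[of m n] in auto)
  also have "\<dots> = psubst_monom f m * psubst_monom f n"
    by (simp add: lookup_add power_add prod.distrib psubst_monom_superset[where B = ?B])
  finally show ?thesis .
qed

lemma psubst_superset:
  "\<lbrakk>finite B; Poly_Mapping.keys p \<subseteq> B\<rbrakk> \<Longrightarrow>
    psubst f p = (\<Sum>m\<in>B. pconst (Poly_Mapping.lookup p m) * psubst_monom f m)"
  unfolding psubst_eq
  by (rule sum.mono_neutral_left) (auto simp: in_keys_iff pconst_simps)

lemma psubst_add: "psubst f (p + q) = psubst f p + psubst f q"
proof -
  let ?B = "Poly_Mapping.keys p \<union> Poly_Mapping.keys q"
  have "psubst f (p + q) = (\<Sum>m\<in>?B. pconst (Poly_Mapping.lookup (p + q) m) * psubst_monom f m)"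
    by (rule psubst_superset) (use keys_add[of p q] in auto)
  also have "\<dots> = psubst f p + psubst f q"
    by (simp add: lookup_add pconst_simps distrib_right sum.distrib psubst_superset[where B = ?B])
  finally show ?thesis .
qed

lemma psubst_single: "psubst f (Poly_Mapping.single m c) = pconst c * psubst_monom f m"
  by (simp add: psubst_eq pconst_simps)

lemma psubst_0: "psubst f 0 = 0"
  by (simp add: psubst_eq)

lemma psubst_sum: "psubst f (sum g B) = (\<Sum>i\<in>B. psubst f (g i))"
  by (induction B rule: infinite_finite_induct) (auto simp: psubst_0 psubst_add)

lemma poly_mapping_eq_sum_single:
  fixes p :: "'x \<Rightarrow>\<^sub>0 'b::comm_monoid_add"
  shows "p = (\<Sum>m\<in>Poly_Mapping.keys p. Poly_Mapping.single m (Poly_Mapping.lookup p m))"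
  by (rule poly_mapping_eqI)
    (auto simp: lookup_sum lookup_single when_def sum.delta in_keys_iff)

lemma psubst_mult: "psubst f (p * q) = psubst f p * psubst f q"
proof -
  have "p * q = (\<Sum>m\<in>Poly_Mapping.keys p. \<Sum>n\<in>Poly_Mapping.keys q.
      Poly_Mapping.single (m + n) (Poly_Mapping.lookup p m * Poly_Mapping.lookup q n))"
    unfolding mult_single[symmetric] sum_product[symmetric]
    by (simp only: poly_mapping_eq_sum_single[symmetric])
  then show ?thesis
    by (simp add: psubst_sum psubst_single psubst_eq[of f p] psubst_eq[of f q] sum_product
        psubst_monom_add pconst_simps ac_simps)
qed

lemma psubst_pconst: "psubst f (pconst c) = pconst c"
  by (simp add: pconst_def psubst_single psubst_monom_def)

lemma psubst_1: "psubst f 1 = 1"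
  using psubst_pconst[of f 1] by (simp add: pconst_simps)

lemma psubst_pvar: "psubst f (pvar x) = f x"
  by (simp add: pvar_def psubst_single psubst_monom_def pconst_simps)

lemma psubst_diff: "psubst f (p - q) = psubst f p - psubst f q"
  using psubst_add[of f "p - q" q] by simp

lemma psubst_power: "psubst f (p ^ n) = psubst f p ^ n"
  by (induction n) (auto simp: psubst_1 psubst_mult)

lemma psubst_prod: "psubst f (prod g B) = (\<Prod>i\<in>B. psubst f (g i))"
  by (induction B rule: infinite_finite_induct) (auto simp: psubst_1 psubst_mult)

lemma psubst_psubst: "psubst f (psubst h p) = psubst (\<lambda>x. psubst f (h x)) p"
  by (simp add: psubst_def[of h] psubst_def[of "\<lambda>x. psubst f (h x)"] psubst_sum psubst_mult
      psubst_prod psubst_power psubst_pconst)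

lemma psubst_pvar_id:
  fixes p :: "('x, 'k::comm_ring_1) mpoly"
  shows "psubst pvar p = p"
proof -
  have pow: "pvar x ^ k = (Poly_Mapping.single (Poly_Mapping.single x k) 1 :: ('x, 'k) mpoly)"
    for x :: 'x and k
    by (induction k) (auto simp: pvar_def mult_single single_add[symmetric])
  have "(\<Prod>x\<in>B. Poly_Mapping.single (g x) 1) = (Poly_Mapping.single (sum g B) 1 :: ('x, 'k) mpoly)"
    for g and B :: "'x set"
    by (induction B rule: infinite_finite_induct) (auto simp: mult_single)
  then have "psubst_monom pvar m = (Poly_Mapping.single m 1 :: ('x, 'k) mpoly)" for m
    unfolding psubst_monom_def pow by (simp only: poly_mapping_eq_sum_single[symmetric])
  then have "psubst pvar p = (\<Sum>m\<in>Poly_Mapping.keys p. Poly_Mapping.single m (Poly_Mapping.lookup p m))"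
    by (simp add: psubst_eq pconst_def mult_single)
  then show ?thesis by (simp only: poly_mapping_eq_sum_single[symmetric])
qed

definition polys_in :: "'x set \<Rightarrow> ('x, 'k::comm_ring_1) mpoly set"
  where "polys_in I = {p. \<forall>m\<in>Poly_Mapping.keys p. Poly_Mapping.keys m \<subseteq> I}"

lemma mvpoly_ring_simps [simp]:
  "carrier (mvpoly_ring I) = polys_in I" "monoid.mult (mvpoly_ring I) = (*)" "one (mvpoly_ring I) = 1"
  "ring.zero (mvpoly_ring I) = 0" "add (mvpoly_ring I) = (+)"
  by (simp_all add: mvpoly_ring_def ring_of_type_algebra_def polys_in_def)

lemma polys_in_1: "1 \<in> polys_in I"
  by (simp add: polys_in_def)

lemma polys_in_diff: "\<lbrakk>p \<in> polys_in I; q \<in> polys_in I\<rbrakk> \<Longrightarrow> p - q \<in> polys_in I"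
proof -
  have "Poly_Mapping.keys (p - q) \<subseteq> Poly_Mapping.keys p \<union> Poly_Mapping.keys q"
    by (auto simp: in_keys_iff lookup_minus)
  then show "p \<in> polys_in I \<Longrightarrow> q \<in> polys_in I \<Longrightarrow> p - q \<in> polys_in I"
    by (auto simp: polys_in_def)
qed

lemma polys_in_0: "0 \<in> polys_in I"
  by (simp add: polys_in_def)

lemma polys_in_uminus: "p \<in> polys_in I \<Longrightarrow> - p \<in> polys_in I"
  using polys_in_diff[OF polys_in_0, of p I] by simp

lemma polys_in_add: "\<lbrakk>p \<in> polys_in I; q \<in> polys_in I\<rbrakk> \<Longrightarrow> p + q \<in> polys_in I"
  using polys_in_diff[OF _ polys_in_uminus, of p I q] by simp

lemma polys_in_mult:
  assumes "p \<in> polys_in I" "q \<in> polys_in I"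
  shows "p * q \<in> polys_in I"
  unfolding polys_in_def
proof (intro CollectI ballI)
  fix m assume "m \<in> Poly_Mapping.keys (p * q)"
  then obtain a b where "m = a + b" "a \<in> Poly_Mapping.keys p" "b \<in> Poly_Mapping.keys q"
    using keys_mult[of p q] by auto
  then show "Poly_Mapping.keys m \<subseteq> I"
    using keys_add[of a b] assms by (auto simp: polys_in_def)
qed

lemma polys_in_pconst: "pconst c \<in> polys_in I"
  by (simp add: polys_in_def pconst_def)

lemma polys_in_pvar: "x \<in> I \<Longrightarrow> pvar x \<in> polys_in I"
  by (simp add: polys_in_def pvar_def)

lemma polys_in_sum: "(\<And>i. i \<in> B \<Longrightarrow> f i \<in> polys_in I) \<Longrightarrow> sum f B \<in> polys_in I"
  by (induction B rule: infinite_finite_induct) (auto intro: polys_in_0 polys_in_add)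

lemma polys_in_prod: "(\<And>i. i \<in> B \<Longrightarrow> f i \<in> polys_in I) \<Longrightarrow> prod f B \<in> polys_in I"
  by (induction B rule: infinite_finite_induct) (auto intro: polys_in_1 polys_in_mult)

lemma polys_in_power: "p \<in> polys_in I \<Longrightarrow> p ^ n \<in> polys_in I"
  by (induction n) (auto intro: polys_in_1 polys_in_mult)

lemma polys_in_psubst:
  assumes p: "p \<in> polys_in I" and f: "\<And>x. x \<in> I \<Longrightarrow> f x \<in> polys_in K"
  shows "psubst f p \<in> polys_in K"
proof -
  have "f x \<in> polys_in K" if "m \<in> Poly_Mapping.keys p" "x \<in> Poly_Mapping.keys m" for m x
    using that p by (intro f) (auto simp: polys_in_def)
  then show ?thesis
    unfolding psubst_def
    by (intro polys_in_sum polys_in_mult polys_in_pconst polys_in_prod polys_in_power)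
qed

lemma cring_mvpoly_ring: "cring (mvpoly_ring I :: ('x, 'k::comm_ring_1) mpoly ring)"
  (is "cring ?R")
proof (rule cringI)
  show "abelian_group ?R"
  proof (rule abelian_groupI)
    fix p assume "p \<in> carrier ?R"
    then show "\<exists>q\<in>carrier ?R. q \<oplus>\<^bsub>?R\<^esub> p = \<zero>\<^bsub>?R\<^esub>"
      by (intro bexI[of _ "- p"]) (auto intro: polys_in_uminus)
  qed (auto intro: polys_in_add polys_in_0)
  show "Group.comm_monoid ?R"
    by (rule comm_monoidI) (auto intro: polys_in_mult polys_in_1 simp: ac_simps)
qed (auto simp: distrib_right)

lemma
  fixes f :: "'i \<Rightarrow> ('x, 'k::comm_ring_1) mpoly"
  assumes "\<And>i. i \<in> B \<Longrightarrow> f i \<in> polys_in I"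
  shows finsum_mvpoly_ring: "finsum (mvpoly_ring I) f B = sum f B"
    and finprod_mvpoly_ring: "finprod (mvpoly_ring I) f B = prod f B"
proof -
  interpret cring "mvpoly_ring I :: ('x, 'k) mpoly ring" by (rule cring_mvpoly_ring)
  show "finsum (mvpoly_ring I) f B = sum f B"
    using assms by (induction B rule: infinite_finite_induct) (auto simp: Pi_iff)
  show "finprod (mvpoly_ring I) f B = prod f B"
    using assms by (induction B rule: infinite_finite_induct) (auto simp: Pi_iff)
qed

section \<open>The coordinate ring and the top Dickson class\<close>

lemma (in ideal) coset_image:
  assumes add: "\<And>x y. f (x \<oplus> y) = f x \<oplus> f y" and I: "f ` I = I"
  shows "f ` (I +> a) = I +> f a"
proof -
  have "f ` (I +> a) = (\<Union>h\<in>I. {f h \<oplus> f a})"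
    by (simp add: a_r_coset_def' image_UN add)
  also have "\<dots> = (\<Union>h\<in>f ` I. {h \<oplus> f a})" by simp
  also have "\<dots> = I +> f a" unfolding I a_r_coset_def' ..
  finally show ?thesis .
qed

text \<open>
  The group acts on the polynomial ring \<open>T\<close> by the substitutions \<open>sub g\<close>, and this action descends
  along the projection \<open>cls\<close> to the coordinate ring.
\<close>

locale linear_group_action = finite_dimensional_vector_space scale Basis
  for scale :: "'k::{field,finite} \<Rightarrow> 'v::ab_group_add \<Rightarrow> 'v" and Basis :: "'v set" +
  fixes H :: "('v \<Rightarrow> 'v) set"
  assumes subgroup_H: "subgroup H (GL scale)"
begin

abbreviation "G \<equiv> (GL scale)\<lparr>carrier := H\<rparr>"
abbreviation "D \<equiv> dual_space scale"
abbreviation T :: "('v \<Rightarrow> 'k, 'k) mpoly ring" where "T \<equiv> mvpoly_ring D"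
abbreviation "J \<equiv> dual_relations_ideal scale"
abbreviation sub :: "('v \<Rightarrow> 'v) \<Rightarrow> ('v \<Rightarrow> 'k, 'k) mpoly \<Rightarrow> ('v \<Rightarrow> 'k, 'k) mpoly"
  where "sub g \<equiv> psubst (\<lambda>\<phi>. pvar (dual_act g \<phi>))"
abbreviation "cls p \<equiv> J +>\<^bsub>T\<^esub> p"
abbreviation "R \<equiv> coordinate_ring scale"

lemma linear_eqs:
  assumes "Vector_Spaces.linear scale scale g"
  shows "g (x + y) = g x + g y" "g (scale c x) = scale c (g x)"
  using assms by (auto simp: Vector_Spaces.linear_iff)

lemma dual_spaceI:
  "\<lbrakk>\<And>x y. \<phi> (x + y) = \<phi> x + \<phi> y; \<And>c x. \<phi> (scale c x) = c * \<phi> x\<rbrakk> \<Longrightarrow> \<phi> \<in> D"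
proof -
  have "vector_space ((*) :: 'k \<Rightarrow> 'k \<Rightarrow> 'k)"
    by unfold_locales (auto simp: algebra_simps)
  then show "(\<And>x y. \<phi> (x + y) = \<phi> x + \<phi> y) \<Longrightarrow> (\<And>c x. \<phi> (scale c x) = c * \<phi> x) \<Longrightarrow> \<phi> \<in> D"
    using vector_space_axioms by (simp add: dual_space_def Vector_Spaces.linear_iff)
qed

lemma dual_spaceD:
  assumes "\<phi> \<in> D"
  shows "\<phi> (x + y) = \<phi> x + \<phi> y" "\<phi> (scale c x) = c * \<phi> x"
  using assms by (auto simp: dual_space_def Vector_Spaces.linear_iff)

lemma dual_space_add: "\<lbrakk>\<phi> \<in> D; \<psi> \<in> D\<rbrakk> \<Longrightarrow> (\<lambda>v. \<phi> v + \<psi> v) \<in> D"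
  by (rule dual_spaceI) (auto simp: dual_spaceD algebra_simps)

lemma dual_space_scale: "\<phi> \<in> D \<Longrightarrow> (\<lambda>v. c * \<phi> v) \<in> D"
  by (rule dual_spaceI) (auto simp: dual_spaceD algebra_simps)

text \<open>
  A finite-dimensional space over a finite field is finite. Both the group and the product that
  defines the Dickson class are finite for this reason.
\<close>

lemma finite_UNIV_vectors: "finite (UNIV :: 'v set)"
proof -
  have inj: "inj_on (\<lambda>v. restrict (representation Basis v) Basis) UNIV"
  proof (rule inj_onI)
    fix v w assume "restrict (representation Basis v) Basis = restrict (representation Basis w) Basis"
    then have eq: "representation Basis v b = representation Basis w b" if "b \<in> Basis" for b
      using that by (metis restrict_apply')
    have "v = (\<Sum>b\<in>Basis. scale (representation Basis v b) b)"
      using independent_Basis span_Basis finite_Basis by (simp add: sum_representation_eq)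
    also have "\<dots> = (\<Sum>b\<in>Basis. scale (representation Basis w b) b)" by (simp add: eq)
    also have "\<dots> = w"
      using independent_Basis span_Basis finite_Basis by (simp add: sum_representation_eq)
    finally show "v = w" .
  qed
  have fin: "finite (Basis \<rightarrow>\<^sub>E (UNIV :: 'k set))"
    by (rule finite_PiE) (auto simp: finite_Basis)
  show ?thesis
    by (rule inj_on_finite[OF inj _ fin]) auto
qed

lemma finite_functions_on_vectors: "finite (F :: ('v \<Rightarrow> 'b) set)" if "finite (UNIV :: 'b set)"
proof (rule finite_subset)
  show "F \<subseteq> UNIV \<rightarrow>\<^sub>E UNIV" by auto
  show "finite (UNIV \<rightarrow>\<^sub>E UNIV :: ('v \<Rightarrow> 'b) set)"
    by (rule finite_PiE) (auto simp: finite_UNIV_vectors that)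
qed

lemma finite_D: "finite D"
  by (rule finite_functions_on_vectors) simp

lemma functional_separates:
  assumes "v \<noteq> w"
  obtains \<phi> where "\<phi> \<in> D" "\<phi> v \<noteq> \<phi> w"
proof -
  have "\<exists>b\<in>Basis. representation Basis v b \<noteq> representation Basis w b"
  proof (rule ccontr)
    assume "\<not> ?thesis"
    then have "(\<Sum>b\<in>Basis. scale (representation Basis v b) b) = (\<Sum>b\<in>Basis. scale (representation Basis w b) b)"
      by simp
    then show False
      using independent_Basis span_Basis finite_Basis assms by (simp add: sum_representation_eq)
  qed
  then obtain b where b: "representation Basis v b \<noteq> representation Basis w b" by blast
  show thesis
  proof (rule that)
    show "(\<lambda>v. representation Basis v b) \<in> D"
      unfolding dual_space_def
      using linear_representation[OF independent_Basis span_Basis, of b] by simp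
  qed (rule b)
qed

lemma group_GL: "group (GL scale)"
proof (rule groupI)
  fix g h assume "g \<in> carrier (GL scale)" "h \<in> carrier (GL scale)"
  then show "g \<otimes>\<^bsub>GL scale\<^esub> h \<in> carrier (GL scale)"
    by (auto simp: GL_def Vector_Spaces.linear_iff intro: bij_comp)
next
  show "\<one>\<^bsub>GL scale\<^esub> \<in> carrier (GL scale)"
    using vector_space_axioms by (auto simp: GL_def Vector_Spaces.linear_iff)
next
  fix g assume g: "g \<in> carrier (GL scale)"
  then have b: "bij g" and l: "Vector_Spaces.linear scale scale g" by (auto simp: GL_def)
  have g_inv: "g (inv_into UNIV g x) = x" for x using b by (simp add: bij_is_surj surj_f_inv_f)
  have "Vector_Spaces.linear scale scale (inv_into UNIV g)"
    unfolding Vector_Spaces.linear_iff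
  proof (intro conjI allI)
    fix x y c
    have "g (inv_into UNIV g (x + y)) = g (inv_into UNIV g x + inv_into UNIV g y)" by (simp add: linear_eqs[OF l] g_inv)
    then show "inv_into UNIV g (x + y) = inv_into UNIV g x + inv_into UNIV g y" using b by (auto dest: bij_is_inj injD)
    have "g (inv_into UNIV g (scale c x)) = g (scale c (inv_into UNIV g x))" by (simp add: linear_eqs[OF l] g_inv)
    then show "inv_into UNIV g (scale c x) = scale c (inv_into UNIV g x)" using b by (auto dest: bij_is_inj injD)
  qed (rule vector_space_axioms)+
  then show "\<exists>h\<in>carrier (GL scale). h \<otimes>\<^bsub>GL scale\<^esub> g = \<one>\<^bsub>GL scale\<^esub>"
    using b by (intro bexI[of _ "inv_into UNIV g"]) (auto simp: GL_def bij_imp_bij_inv bij_is_inj)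
qed (auto simp: GL_def o_assoc)

sublocale G: group G
  by (rule subgroup.subgroup_is_group[OF subgroup_H group_GL])

lemma GL_simps [simp]: "g \<otimes>\<^bsub>GL scale\<^esub> h = g \<circ> h" "\<one>\<^bsub>GL scale\<^esub> = id"
  by (simp_all add: GL_def)

lemma H_bij: "g \<in> H \<Longrightarrow> bij g" and H_linear: "g \<in> H \<Longrightarrow> Vector_Spaces.linear scale scale g"
  using subgroup.subset[OF subgroup_H] by (auto simp: GL_def)

lemma inv_in_H: "g \<in> H \<Longrightarrow> inv_into UNIV g \<in> H"
proof -
  assume g: "g \<in> H"
  have "inv\<^bsub>G\<^esub> g \<circ> g = id" "g \<circ> inv\<^bsub>G\<^esub> g = id" "inv\<^bsub>G\<^esub> g \<in> H"
    using G.l_inv[of g] G.r_inv[of g] G.inv_closed[of g] g by auto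
  then show ?thesis
    using inv_unique_comp[of g "inv\<^bsub>G\<^esub> g"] by simp
qed

lemma finite_H: "finite H"
  by (rule finite_functions_on_vectors[OF finite_UNIV_vectors])

lemma dual_act_comp: "\<lbrakk>g \<in> H; h \<in> H\<rbrakk> \<Longrightarrow> dual_act (g \<circ> h) \<phi> = dual_act g (dual_act h \<phi>)"
  by (simp add: dual_act_def o_inv_distrib H_bij o_assoc)

lemma dual_act_id: "dual_act id \<phi> = \<phi>"
  by (simp add: dual_act_def)

lemma dual_act_inv: "g \<in> H \<Longrightarrow> dual_act g (dual_act (inv_into UNIV g) \<phi>) = \<phi>"
  using dual_act_comp[of g "inv_into UNIV g" \<phi>] inv_in_H[of g] H_bij[of g]
  by (simp add: dual_act_id bij_is_surj surj_iff[THEN iffD1])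

lemma dual_act_inv': "g \<in> H \<Longrightarrow> dual_act (inv_into UNIV g) (dual_act g \<phi>) = \<phi>"
  using dual_act_comp[of "inv_into UNIV g" g \<phi>] inv_in_H[of g] H_bij[of g]
  by (simp add: dual_act_id bij_is_inj)

lemma dual_act_D: "g \<in> H \<Longrightarrow> \<phi> \<in> D \<Longrightarrow> dual_act g \<phi> \<in> D"
  by (rule dual_spaceI)
    (auto simp: dual_act_def dual_spaceD linear_eqs[OF H_linear[OF inv_in_H]])

text \<open>
  The action on the dual space is faithful, because linear forms separate points.
\<close>

lemma dual_act_moves:
  assumes g: "g \<in> H" "g \<noteq> id"
  obtains \<phi> where "\<phi> \<in> D" "dual_act g \<phi> \<noteq> \<phi>"
proof -
  obtain v where "g v \<noteq> v" using g(2) by (auto simp: fun_eq_iff)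
  then obtain \<phi> where \<phi>: "\<phi> \<in> D" "\<phi> (g v) \<noteq> \<phi> v" by (rule functional_separates)
  have "dual_act g \<phi> (g v) = \<phi> v" using H_bij[OF g(1)] by (simp add: dual_act_def bij_is_inj)
  with \<phi> show thesis using that by metis
qed

sublocale T: cring T
  by (rule cring_mvpoly_ring)

lemma relations_subset: "dual_relations scale \<subseteq> polys_in D"
  by (auto simp: dual_relations_def dual_space_add dual_space_scale
      intro!: polys_in_diff polys_in_add polys_in_mult polys_in_pconst polys_in_pvar)

sublocale J: ideal J T
  unfolding dual_relations_ideal_def
  by (rule T.genideal_ideal) (use relations_subset in simp)

lemma relations_in_J: "dual_relations scale \<subseteq> J"
  unfolding dual_relations_ideal_def
  by (rule T.genideal_self) (use relations_subset in simp)

lemma pvar_add_in_J: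
  assumes "\<phi> \<in> D" "\<psi> \<in> D"
  shows "pvar (\<lambda>v. \<phi> v + \<psi> v) - (pvar \<phi> + pvar \<psi>) \<in> J"
  by (rule subsetD[OF relations_in_J]) (use assms in \<open>unfold dual_relations_def, blast\<close>)

lemma pvar_scale_in_J:
  assumes "\<phi> \<in> D"
  shows "pvar (\<lambda>v. c * \<phi> v) - pconst c * pvar \<phi> \<in> J"
  by (rule subsetD[OF relations_in_J]) (use assms in \<open>unfold dual_relations_def, blast\<close>)

lemma J_subset: "J \<subseteq> polys_in D"
  using J.Icarr by auto

lemma J_add: "x \<in> J \<Longrightarrow> y \<in> J \<Longrightarrow> x + y \<in> J"
  using J.a_closed by simp

lemma J_zero: "0 \<in> J"
  using J.zero_closed by simp

lemma J_mult: "x \<in> polys_in D \<Longrightarrow> y \<in> J \<Longrightarrow> x * y \<in> J"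
  using J.I_l_closed[of y x] by simp

lemma sub_polys: "g \<in> H \<Longrightarrow> p \<in> polys_in D \<Longrightarrow> sub g p \<in> polys_in D"
  by (rule polys_in_psubst) (auto intro: polys_in_pvar dual_act_D)

lemma sub_comp: "\<lbrakk>g \<in> H; h \<in> H\<rbrakk> \<Longrightarrow> sub (g \<circ> h) p = sub g (sub h p)"
  by (simp add: psubst_psubst psubst_pvar dual_act_comp)

lemma sub_id: "sub id p = p"
  by (simp add: dual_act_id psubst_pvar_id)

lemma sub_relation:
  assumes "g \<in> H" "x \<in> dual_relations scale"
  shows "sub g x \<in> dual_relations scale"
  using assms(2) unfolding dual_relations_def
proof (elim UnE CollectE exE conjE)
  fix \<phi> \<psi> assume "x = pvar (\<lambda>v. \<phi> v + \<psi> v) - (pvar \<phi> + pvar \<psi>)" "\<phi> \<in> D" "\<psi> \<in> D"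
  then have "sub g x = pvar (\<lambda>v. dual_act g \<phi> v + dual_act g \<psi> v) - (pvar (dual_act g \<phi>) + pvar (dual_act g \<psi>))"
    by (simp add: psubst_diff psubst_add psubst_pvar dual_act_def comp_def)
  with dual_act_D[OF assms(1)] \<open>\<phi> \<in> D\<close> \<open>\<psi> \<in> D\<close>
  show "sub g x \<in> {pvar (\<lambda>v. \<phi> v + \<psi> v) - (pvar \<phi> + pvar \<psi>) |\<phi> \<psi>. \<phi> \<in> D \<and> \<psi> \<in> D} \<union>
    {pvar (\<lambda>v. c * \<phi> v) - pconst c * pvar \<phi> |c \<phi>. \<phi> \<in> D}" by blast
next
  fix c \<phi> assume "x = pvar (\<lambda>v. c * \<phi> v) - pconst c * pvar \<phi>" "\<phi> \<in> D"
  then have "sub g x = pvar (\<lambda>v. c * dual_act g \<phi> v) - pconst c * pvar (dual_act g \<phi>)"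
    by (simp add: psubst_diff psubst_mult psubst_pvar psubst_pconst dual_act_def comp_def)
  with dual_act_D[OF assms(1)] \<open>\<phi> \<in> D\<close>
  show "sub g x \<in> {pvar (\<lambda>v. \<phi> v + \<psi> v) - (pvar \<phi> + pvar \<psi>) |\<phi> \<psi>. \<phi> \<in> D \<and> \<psi> \<in> D} \<union>
    {pvar (\<lambda>v. c * \<phi> v) - pconst c * pvar \<phi> |c \<phi>. \<phi> \<in> D}" by blast
qed

lemma sub_ring_hom: "g \<in> H \<Longrightarrow> sub g \<in> ring_hom T T"
  by (rule ring_hom_memI) (auto simp: sub_polys psubst_mult psubst_add psubst_1)

lemma cls_ring_hom: "(\<lambda>p. cls p) \<in> ring_hom T R"
  unfolding coordinate_ring_def by (rule J.rcos_ring_hom)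

lemma cring_R: "cring R"
  unfolding coordinate_ring_def by (rule J.quotient_is_cring[OF T.cring_axioms])

sublocale R: cring R
  by (rule cring_R)

sublocale cls: ring_hom_cring T R "\<lambda>p. cls p"
  by (intro ring_hom_cring.intro ring_hom_cring_axioms.intro T.cring_axioms cring_R cls_ring_hom)

lemma cls_eqI:
  assumes "p \<in> polys_in D" "q \<in> polys_in D" "p - q \<in> J"
  shows "cls p = cls q"
proof -
  have "p \<in> cls q"
    unfolding a_r_coset_def' using assms(3) by (auto intro!: bexI[of _ "p - q"])
  from J.a_repr_independence'[OF this] show ?thesis
    using assms(2) by simp
qed

lemma carrier_R: "carrier R = (\<lambda>p. cls p) ` polys_in D"
  by (auto simp: coordinate_ring_def FactRing_def A_RCOSETS_def')

text \<open>
  The polynomials whose images under \<open>sub g\<close> lie in \<open>J\<close> form the kernel of a ring homomorphism, hence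
  an ideal; it contains the defining relations because \<open>g\<close> permutes them.
\<close>

lemma sub_J_subset: "g \<in> H \<Longrightarrow> sub g ` J \<subseteq> J"
proof -
  assume g: "g \<in> H"
  interpret c: ring_hom_ring T R "(\<lambda>p. cls p) \<circ> sub g"
    by (rule ring_hom_ringI2[OF T.ring_axioms R.ring_axioms ring_hom_trans[OF sub_ring_hom[OF g] cls_ring_hom]])
  have "Idl\<^bsub>T\<^esub> (dual_relations scale) \<subseteq> a_kernel T R ((\<lambda>p. cls p) \<circ> sub g)"
  proof (rule T.genideal_minimal[OF c.kernel_is_ideal])
    show "dual_relations scale \<subseteq> a_kernel T R ((\<lambda>p. cls p) \<circ> sub g)"
    proof
      fix x assume x: "x \<in> dual_relations scale"
      have "sub g x \<in> J" using sub_relation[OF g x] relations_in_J by auto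
      then have "cls (sub g x) = cls 0"
        using J_subset by (intro cls_eqI polys_in_0) auto
      then have "((\<lambda>p. cls p) \<circ> sub g) x = \<zero>\<^bsub>R\<^esub>" using cls.hom_zero by simp
      moreover have "x \<in> carrier T" using x relations_subset by auto
      ultimately show "x \<in> a_kernel T R ((\<lambda>p. cls p) \<circ> sub g)"
        unfolding a_kernel_def' by blast
    qed
  qed
  then have "cls (sub g x) = \<zero>\<^bsub>R\<^esub>" if "x \<in> J" for x
    using that unfolding dual_relations_ideal_def a_kernel_def' by (simp add: subset_iff)
  moreover have "\<zero>\<^bsub>R\<^esub> = J" by (simp add: coordinate_ring_def FactRing_def)
  ultimately have "cls (sub g x) = J" "sub g x \<in> carrier T" if "x \<in> J" for x
    using that J_subset sub_polys[OF g, of x] by auto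
  then show ?thesis
    by (intro image_subsetI J.rcos_const_imp_mem)
qed

lemma sub_J: "g \<in> H \<Longrightarrow> sub g ` J = J"
proof
  assume g: "g \<in> H"
  show "J \<subseteq> sub g ` J"
  proof
    fix x assume x: "x \<in> J"
    have "g \<circ> inv_into UNIV g = id" using H_bij[OF g] by (simp add: bij_is_surj surj_iff[THEN iffD1])
    then have "sub g (sub (inv_into UNIV g) x) = x"
      using sub_comp[OF g inv_in_H[OF g], of x] by (simp add: sub_id)
    then show "x \<in> sub g ` J"
      using sub_J_subset[OF inv_in_H[OF g]] x by (metis image_eqI image_subset_iff)
  qed
qed (rule sub_J_subset)

text \<open>
  The image of a coset as a set is a full coset, because \<open>sub g\<close> maps \<open>J\<close> onto itself and not merely
  into itself.
\<close>

lemma coordinate_act_cls: "g \<in> H \<Longrightarrow> coordinate_act g (cls p) = cls (sub g p)"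
  unfolding coordinate_act_def
  by (rule J.coset_image) (simp_all add: psubst_add sub_J)

sublocale ring_action R G coordinate_act
proof (intro ring_action.intro ring_action_axioms.intro)
  fix g assume "g \<in> carrier G"
  then have g: "g \<in> H" by simp
  show "coordinate_act g \<in> ring_hom R R"
  proof (rule ring_hom_memI)
    fix x y assume "x \<in> carrier R" "y \<in> carrier R"
    then obtain p q where p: "p \<in> polys_in D" "x = cls p" and q: "q \<in> polys_in D" "y = cls q"
      unfolding carrier_R by blast
    show "coordinate_act g x \<in> carrier R"
      using p g by (simp add: coordinate_act_cls carrier_R sub_polys)
    have "x \<otimes>\<^bsub>R\<^esub> y = cls (p * q)" "x \<oplus>\<^bsub>R\<^esub> y = cls (p + q)"
      using cls.hom_mult[of p q] cls.hom_add[of p q] p q by simp_all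
    then show "coordinate_act g (x \<otimes>\<^bsub>R\<^esub> y) = coordinate_act g x \<otimes>\<^bsub>R\<^esub> coordinate_act g y"
      and "coordinate_act g (x \<oplus>\<^bsub>R\<^esub> y) = coordinate_act g x \<oplus>\<^bsub>R\<^esub> coordinate_act g y"
      using cls.hom_mult[of "sub g p" "sub g q"] cls.hom_add[of "sub g p" "sub g q"] p q g
      by (simp_all add: coordinate_act_cls psubst_mult psubst_add sub_polys)
  next
    show "coordinate_act g \<one>\<^bsub>R\<^esub> = \<one>\<^bsub>R\<^esub>"
      using cls.hom_one g by (metis coordinate_act_cls mvpoly_ring_simps(3) psubst_1)
  qed
next
  fix g h x assume gh: "g \<in> carrier G" "h \<in> carrier G" and "x \<in> carrier R"
  then obtain p where "p \<in> polys_in D" "x = cls p" unfolding carrier_R by blast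
  moreover have "g \<circ> h \<in> H" using G.m_closed[OF gh] by simp
  ultimately show "coordinate_act (g \<otimes>\<^bsub>G\<^esub> h) x = coordinate_act g (coordinate_act h x)"
    using gh by (simp add: coordinate_act_cls sub_comp)
next
  fix x assume "x \<in> carrier R"
  then obtain p where "x = cls p" unfolding carrier_R by blast
  then show "coordinate_act \<one>\<^bsub>G\<^esub> x = x"
    using G.one_closed by (simp add: coordinate_act_cls sub_id)
qed (simp_all add: R.cring_axioms G.group_axioms finite_H)

sublocale poly: subring_action G sub "polys_in D"
  by (intro subring_action.intro subring_action_axioms.intro G.group_axioms)
    (auto simp: finite_H psubst_add psubst_mult psubst_1 sub_comp sub_id polys_in_1 polys_in_diff
      polys_in_mult sub_polys)

text \<open>
  A representative of the top Dickson class. The group permutes its factors, so it is invariant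
  already as a polynomial, before passing to the quotient.
\<close>

definition dickson_poly :: "('v \<Rightarrow> 'k, 'k) mpoly"
  where "dickson_poly = (\<Prod>\<phi>\<in>D - {\<lambda>v. 0}. pvar \<phi>)"

lemma dickson_poly_polys: "dickson_poly \<in> polys_in D"
  unfolding dickson_poly_def by (intro polys_in_prod polys_in_pvar) auto

lemma top_dickson_cls: "top_dickson scale = cls dickson_poly"
proof -
  have "cls (finprod T pvar (D - {\<lambda>v. 0})) = finprod R (\<lambda>\<phi>. cls (pvar \<phi>)) (D - {\<lambda>v. 0})"
    using cls.hom_finprod[of pvar "D - {\<lambda>v. 0}"] by (simp add: polys_in_pvar Pi_iff comp_def)
  moreover have "finprod T pvar (D - {\<lambda>v. 0}) = dickson_poly"
    unfolding dickson_poly_def by (rule finprod_mvpoly_ring) (auto intro: polys_in_pvar)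
  ultimately show ?thesis
    by (simp add: top_dickson_def linear_form_def)
qed

lemma dickson_poly_invariant: "dickson_poly \<in> poly.invariants"
proof -
  have "sub g dickson_poly = dickson_poly" if g: "g \<in> H" for g
  proof -
    have zero: "dual_act h (\<lambda>v. 0) = (\<lambda>v. 0)" for h :: "'v \<Rightarrow> 'v" by (simp add: dual_act_def comp_def)
    have ne: "dual_act h \<phi> \<in> D - {\<lambda>v. 0}" if h: "h \<in> H" and \<phi>: "\<phi> \<in> D - {\<lambda>v. 0}" for h \<phi>
    proof -
      have "dual_act h \<phi> \<noteq> (\<lambda>v. 0)"
        using dual_act_inv'[OF h, of \<phi>] zero[of "inv_into UNIV h"] \<phi> by auto
      then show ?thesis using dual_act_D[OF h] \<phi> by simp
    qed
    have "bij_betw (dual_act g) (D - {\<lambda>v. 0}) (D - {\<lambda>v. 0})"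
    proof (rule bij_betw_byWitness[where f' = "dual_act (inv_into UNIV g)"])
      show "dual_act g ` (D - {\<lambda>v. 0}) \<subseteq> D - {\<lambda>v. 0}"
        using ne[OF g] by (rule image_subsetI)
      show "dual_act (inv_into UNIV g) ` (D - {\<lambda>v. 0}) \<subseteq> D - {\<lambda>v. 0}"
        using ne[OF inv_in_H[OF g]] by (rule image_subsetI)
    qed (simp_all add: dual_act_inv[OF g] dual_act_inv'[OF g])
    from prod.reindex_bij_betw[OF this, of pvar] show ?thesis
      by (simp add: dickson_poly_def psubst_prod psubst_pvar)
  qed
  then show ?thesis using dickson_poly_polys by (simp add: poly.invariants_def)
qed

text \<open>
  If \<open>g\<close> moves \<open>\<phi>\<close>, then \<open>\<phi> - g \<phi>\<close> is a nonzero linear form, and so one of the factors of the Dickson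
  class. The difference of the symbols for \<open>\<phi>\<close> and \<open>g \<phi>\<close> agrees with the symbol for this form only
  modulo \<open>J\<close>.
\<close>

lemma dickson_poly_multiple:
  assumes g: "g \<in> H" "g \<noteq> id"
  shows "\<exists>v\<in>polys_in D. \<exists>e\<in>polys_in D. dickson_poly - (v - sub g v) * e \<in> J"
proof -
  obtain \<phi> where \<phi>: "\<phi> \<in> D" "dual_act g \<phi> \<noteq> \<phi>" using dual_act_moves[OF g] .
  define \<psi> where "\<psi> = dual_act g \<phi>"
  have \<psi>: "\<psi> \<in> D" unfolding \<psi>_def by (rule dual_act_D) fact+
  \<comment> \<open>the form \<open>\<phi> - \<psi>\<close>, spelled as the defining relations of the symmetric algebra have it\<close>
  define \<chi> where "\<chi> = (\<lambda>v. \<phi> v + (- 1) * \<psi> v)"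
  have n\<psi>: "(\<lambda>v. (- 1) * \<psi> v) \<in> D" using \<psi> by (rule dual_space_scale)
  have \<chi>: "\<chi> \<in> D" unfolding \<chi>_def by (rule dual_space_add[OF \<phi>(1) n\<psi>])
  have \<chi>0: "\<chi> \<noteq> (\<lambda>v. 0)" using \<phi>(2) unfolding \<chi>_def \<psi>_def by (force simp: fun_eq_iff)
  have "pvar \<chi> - (pvar \<phi> + pvar (\<lambda>v. (- 1) * \<psi> v)) \<in> J"
    unfolding \<chi>_def by (rule pvar_add_in_J[OF \<phi>(1) n\<psi>])
  moreover have "pvar (\<lambda>v. (- 1) * \<psi> v) - pconst (- 1) * pvar \<psi> \<in> J"
    by (rule pvar_scale_in_J[OF \<psi>])
  ultimately have "(pvar \<chi> - (pvar \<phi> + pvar (\<lambda>v. (- 1) * \<psi> v)))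
      + (pvar (\<lambda>v. (- 1) * \<psi> v) - pconst (- 1) * pvar \<psi>) \<in> J" by (rule J_add)
  moreover have "pconst (- 1) = (- 1 :: ('v \<Rightarrow> 'k, 'k) mpoly)" by (simp add: pconst_def single_uminus)
  ultimately have rel: "pvar \<chi> - (pvar \<phi> - pvar \<psi>) \<in> J" by (simp add: algebra_simps)
  define e :: "('v \<Rightarrow> 'k, 'k) mpoly" where "e = (\<Prod>\<phi>\<in>D - {\<lambda>v. 0} - {\<chi>}. pvar \<phi>)"
  have e: "e \<in> polys_in D" unfolding e_def by (intro polys_in_prod polys_in_pvar) auto
  have "dickson_poly = pvar \<chi> * e"
    unfolding dickson_poly_def e_def using finite_D \<chi> \<chi>0 by (intro prod.remove) auto
  then have "dickson_poly - (pvar \<phi> - sub g (pvar \<phi>)) * e = e * (pvar \<chi> - (pvar \<phi> - pvar \<psi>))"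
    by (simp add: psubst_pvar \<psi>_def algebra_simps)
  then show ?thesis
    using J_mult[OF e rel] e \<phi>(1) by (metis polys_in_pvar)
qed

theorem dickson_power_is_transfer:
  obtains r m where "r \<in> carrier R" "top_dickson scale [^]\<^bsub>R\<^esub> (m :: nat) = transfer r"
proof -
  have "\<exists>p\<in>polys_in D. \<exists>m. dickson_poly ^ m - poly.trace p \<in> J"
    by (rule poly.power_congruent_trace[OF J_zero J_add J_mult _ J_subset dickson_poly_invariant])
      (use sub_J dickson_poly_multiple in auto)
  then obtain p m where p: "p \<in> polys_in D" and m: "dickson_poly ^ m - poly.trace p \<in> J" by blast
  have pow: "cls (q ^ n) = cls q [^]\<^bsub>R\<^esub> n" if q: "q \<in> polys_in D" for q and n :: nat
  proof (induction n)
    case 0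
    then show ?case using cls.hom_one by simp
  next
    case (Suc n)
    then show ?case using cls.hom_mult[of "q ^ n" q] q polys_in_power[OF q, of n] by (simp add: mult.commute)
  qed
  have "transfer (cls p) = finsum R (\<lambda>g. cls (sub g p)) H"
    unfolding transfer_def using p
    by (simp, intro R.finsum_cong') (auto simp: coordinate_act_cls carrier_R sub_polys)
  also have "\<dots> = cls (finsum T (\<lambda>g. sub g p) H)"
    using cls.hom_finsum[of "\<lambda>g. sub g p" H] p by (simp add: sub_polys Pi_iff comp_def)
  also have "finsum T (\<lambda>g. sub g p) H = poly.trace p"
    using p by (simp add: finsum_mvpoly_ring sub_polys poly.trace_def)
  also have "cls (poly.trace p) = cls (dickson_poly ^ m)"
    using m dickson_poly_polys poly.trace_invariant[OF p]
    by (intro cls_eqI[symmetric] polys_in_power) (auto simp: poly.invariants_def)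
  also have "\<dots> = top_dickson scale [^]\<^bsub>R\<^esub> m"
    unfolding top_dickson_cls by (rule pow[OF dickson_poly_polys])
  finally have "top_dickson scale [^]\<^bsub>R\<^esub> m = transfer (cls p)" ..
  moreover have "cls p \<in> carrier R" using p by (simp add: carrier_R)
  ultimately show thesis by (rule that[rotated])
qed

lemma top_dickson_invariant: "top_dickson scale \<in> carrier S"
  using dickson_poly_invariant dickson_poly_polys
  by (auto simp: top_dickson_cls carrier_R coordinate_act_cls poly.invariants_def)

end

theorem theorem1p2:
  fixes scale :: "'k::{field,finite} \<Rightarrow> 'v::ab_group_add \<Rightarrow> 'v"
    and Basis :: "'v set"
    and H :: "('v \<Rightarrow> 'v) set"
    and P :: "nat \<Rightarrow> (('v \<Rightarrow> 'v) \<Rightarrow> ('v \<Rightarrow> 'k, 'k) mpoly set, 'p) module"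
    and \<delta> :: "nat \<Rightarrow> 'p \<Rightarrow> 'p"
    and \<epsilon> :: "'p \<Rightarrow> ('v \<Rightarrow> 'k, 'k) mpoly set"
    and i :: nat
    and G :: "('v \<Rightarrow> 'v) monoid"
    and R S :: "('v \<Rightarrow> 'k, 'k) mpoly set ring"
  defines "G \<equiv> (GL scale)\<lparr>carrier := H\<rparr>"
  defines "R \<equiv> coordinate_ring scale"
  defines "S \<equiv> invariant_ring R G coordinate_act"
  assumes "finite_dimensional_vector_space scale Basis"
    and "subgroup H (GL scale)"
    and "projective_resolution (group_ring S G) P \<delta> \<epsilon> (trivial_module S G)"
    and "i \<ge> 1"
  shows "top_dickson scale \<in>
    ideal_radical S
      (annihilator S (group_cohomology S G P \<delta> (action_module R G coordinate_act) i))"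
proof -
  interpret L: linear_group_action scale Basis H
    using assms(4,5) by (intro linear_group_action.intro linear_group_action_axioms.intro)
  obtain r m where "r \<in> carrier R" "top_dickson scale [^]\<^bsub>R\<^esub> (m :: nat) = L.transfer r"
    unfolding R_def by (rule L.dickson_power_is_transfer)
  then show ?thesis
    using L.radical_annihilator_of_transfer_power[OF assms(6,7)[unfolded S_def R_def G_def]
        L.top_dickson_invariant]
    unfolding S_def R_def G_def by blast
qed

end
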